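(* For each integer $n\ge 2$, the hyperfinite $\mathrm{II}_1$-factor $\mathscr{R}$ contains an uncountable family of pairwise distinct regular $n\times n$ spin model subfactors; that is, there is an uncountable set $\mathcal{U}$ of Hadamard unitaries in $\mathbb{M}_n$ such that the subfactors $\mathscr{R}_u\subseteq\mathscr{R}$, $u\in\mathcal{U}$, are pairwise distinct and each is regular in $\mathscr{R}$.
   Context: $\mathbb{M}_n$ is the algebra of $n\times n$ complex matrices with matrix units $E_{ij}$ and identity $\mathbb{I}_n$, and $\Delta\subset \mathbb{M}_n$ is the algebra of diagonal matrices. A Hadamard unitary in $\mathbb{M}_n$ is a unitary matrix all of whose entries have modulus $n^{-1/2}$. Ambient factor: $\mathscr{R}$ is the hyperfinite $\mathrm{II}_1$-factor obtained as the weak closure, in the GNS representation of the unique normalized trace $\tau$, of $\bigcup_k \mathbb{M}_n^{\otimes k}$, where $\mathbb{M}_n^{\otimes k}\subset\mathbb{M}_n^{\otimes(k+1)}$ via $x\mapsto x\otimes \mathbb{I}_n$. Spin model subfactor: for a Hadamard unitary $u=(u_{ij})\in\mathbb{M}_n$ put $D_u:=\sqrt n\sum_{i,j}\overline{u_{ij}}\,(E_{jj}\otimes E_{ii})$, $u_1:=(u\otimes \mathbb{I}_n)D_u\in\mathbb{M}_n\otimes\Delta$, and for $k\ge1$, $u_{2k-1}:=\prod_{i=0}^{k-1}\big(\mathbb{I}_n^{\otimes i}\otimes u_1\otimes \mathbb{I}_n^{\otimes (k-1-i)}\big)\in\mathbb{M}_n^{\otimes (k+1)}$ (factors ordered from left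 to right with increasing $i$). The algebras $u_{2k-1}(\mathbb{M}_n^{\otimes k}\otimes \mathbb{I}_n)u_{2k-1}^*$ increase with $k$, and $\mathscr{R}_u\subset\mathscr{R}$ is the weak closure of their union; $\mathscr{R}_u$ is called an $n\times n$ spin model subfactor. Regular: a subfactor $N\subseteq M$ is regular if the von Neumann algebra generated by $\{w\in M \text{ unitary}: wNw^*=N\}$ is $M$. *)

theory Defs
  imports "HOL-Analysis.Analysis"
begin

section \<open>Complex Hilbert spaces\<close>

text \<open>
  The complex inner product is antilinear in the first argument; the underlying real inner
  product, hence the norm and the topology, is its real part.
\<close>

class complex_inner = real_inner +
  fixes scaleC :: "complex \<Rightarrow> 'a \<Rightarrow> 'a"  (infixr "*\<^sub>C" 75)
    and cinner :: "'a \<Rightarrow> 'a \<Rightarrow> complex"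
  assumes scaleC_add_right: "a *\<^sub>C (x + y) = a *\<^sub>C x + a *\<^sub>C y"
    and scaleC_add_left: "(a + b) *\<^sub>C x = a *\<^sub>C x + b *\<^sub>C x"
    and scaleC_scaleC: "a *\<^sub>C b *\<^sub>C x = (a * b) *\<^sub>C x"
    and scaleC_of_real: "complex_of_real r *\<^sub>C x = r *\<^sub>R x"
    and cinner_commute: "cinner x y = cnj (cinner y x)"
    and cinner_add_right: "cinner x (y + z) = cinner x y + cinner x z"
    and cinner_scaleC_right: "cinner x (a *\<^sub>C y) = a * cinner x y"
    and inner_eq_Re_cinner: "x \<bullet> y = Re (cinner x y)"

class chilbert_space = complex_inner + complete_space

lemma cinner_scaleC_left:
  "cinner (a *\<^sub>C x) y = cnj a * cinner (x :: 'a :: complex_inner) y"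
  by (metis cinner_commute cinner_scaleC_right complex_cnj_cnj complex_cnj_mult)

lemma inner_scaleC_left: "(a *\<^sub>C x) \<bullet> y = x \<bullet> (cnj a *\<^sub>C (y :: 'a :: complex_inner))"
  by (simp add: inner_eq_Re_cinner cinner_scaleC_left cinner_scaleC_right)

lemma norm_scaleC: "norm (a *\<^sub>C x) = cmod a * norm (x :: 'a :: complex_inner)"
proof -
  have "(norm (a *\<^sub>C x))\<^sup>2 = x \<bullet> ((cnj a * a) *\<^sub>C x)"
    by (simp add: power2_norm_eq_inner inner_scaleC_left scaleC_scaleC)
  also have "cnj a * a = complex_of_real ((cmod a)\<^sup>2)"
    by (metis complex_norm_square mult.commute)
  finally have "(norm (a *\<^sub>C x))\<^sup>2 = (cmod a * norm x)\<^sup>2"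
    by (simp only: scaleC_of_real inner_scaleR_right power2_norm_eq_inner[symmetric] power_mult_distrib)
  then show ?thesis
    by (simp add: power2_eq_iff_nonneg)
qed

lemma bounded_linear_scaleC: "bounded_linear (\<lambda>x :: 'a :: complex_inner. a *\<^sub>C x)"
proof (rule bounded_linear_intro)
  fix x y :: 'a and r :: real
  show "a *\<^sub>C (x + y) = a *\<^sub>C x + a *\<^sub>C y" by (rule scaleC_add_right)
  show "a *\<^sub>C (r *\<^sub>R x) = r *\<^sub>R (a *\<^sub>C x)"
    by (simp add: scaleC_of_real[symmetric] scaleC_scaleC mult.commute)
  show "norm (a *\<^sub>C x) \<le> norm x * cmod a"
    by (simp add: norm_scaleC mult.commute)
qed

lemma cinner_eq_inner:
  "cinner x y = Complex (x \<bullet> y) ((\<i> *\<^sub>C x) \<bullet> (y :: 'a :: complex_inner))"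
  by (simp add: complex_eq_iff inner_eq_Re_cinner cinner_scaleC_left)


section \<open>Hilbert space completion\<close>

text \<open>
  An inner product space embeds isometrically into its real dual by \<open>x \<mapsto> Re \<langle>x, -\<rangle>\<close>. The dual
  is complete, so the closure of the image is a completion; its inner product is obtained from
  the norm by polarization.
\<close>

lemma norm_blinfun_inner_right: "norm (blinfun_inner_right x) = norm (x :: 'a :: real_inner)"
proof (rule antisym)
  show "norm (blinfun_inner_right x) \<le> norm x"
    by (rule norm_blinfun_bound) (simp_all add: Cauchy_Schwarz_ineq2)
  show "norm x \<le> norm (blinfun_inner_right x)"
  proof (cases "x = 0")
    case False
    have "norm x * norm x \<le> norm (blinfun_inner_right x) * norm x"
      using norm_blinfun[of "blinfun_inner_right x" x]
      by (simp add: power2_norm_eq_inner[symmetric] power2_eq_square)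
    then show ?thesis using False by simp
  qed simp
qed

definition completion_carrier :: "('a :: real_inner \<Rightarrow>\<^sub>L real) set" where
  "completion_carrier = closure (range blinfun_inner_right)"

lemma completion_carrier_limit:
  fixes f :: "'a :: real_inner \<Rightarrow>\<^sub>L real"
  assumes "f \<in> completion_carrier"
  obtains x where "(\<lambda>n. blinfun_inner_right (x n)) \<longlonglongrightarrow> f"
proof -
  from assms obtain g where g: "\<And>n. g n \<in> range blinfun_inner_right" "g \<longlonglongrightarrow> f"
    unfolding completion_carrier_def closure_sequential by blast
  have "\<exists>x. \<forall>n. g n = blinfun_inner_right (x n)"
    using g(1) by (intro choice) blast
  then obtain x where "g = (\<lambda>n. blinfun_inner_right (x n))" by blast
  with g(2) that show ?thesis by blast
qed

lemma completion_carrierI: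
  assumes "(\<lambda>n. blinfun_inner_right (x n)) \<longlonglongrightarrow> f"
  shows "f \<in> completion_carrier"
  unfolding completion_carrier_def closure_sequential
  by (rule exI[of _ "\<lambda>n. blinfun_inner_right (x n)"]) (simp add: assms)

lemma subspace_completion_carrier: "subspace (completion_carrier :: ('a :: real_inner \<Rightarrow>\<^sub>L real) set)"
proof -
  interpret B: bounded_linear "blinfun_inner_right :: 'a \<Rightarrow> 'a \<Rightarrow>\<^sub>L real"
    by (rule bounded_linear_blinfun_inner_right)
  show ?thesis
  proof (rule subspaceI)
    show "0 \<in> (completion_carrier :: ('a \<Rightarrow>\<^sub>L real) set)"
      by (rule completion_carrierI[of "\<lambda>_. 0"]) (simp add: B.zero)
  next
    fix f g :: "'a \<Rightarrow>\<^sub>L real"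
    assume "f \<in> completion_carrier" and "g \<in> completion_carrier"
    then obtain x y where "(\<lambda>n. blinfun_inner_right (x n)) \<longlonglongrightarrow> f"
      and "(\<lambda>n. blinfun_inner_right (y n)) \<longlonglongrightarrow> g"
      by (metis completion_carrier_limit)
    then have "(\<lambda>n. blinfun_inner_right (x n + y n)) \<longlonglongrightarrow> f + g"
      unfolding B.add by (rule tendsto_add)
    then show "f + g \<in> completion_carrier" by (rule completion_carrierI)
  next
    fix f :: "'a \<Rightarrow>\<^sub>L real" and r :: real
    assume "f \<in> completion_carrier"
    then obtain x where x: "(\<lambda>n. blinfun_inner_right (x n)) \<longlonglongrightarrow> f"
      by (metis completion_carrier_limit)
    have "(\<lambda>n. blinfun_inner_right (r *\<^sub>R x n)) \<longlonglongrightarrow> r *\<^sub>R f"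
      unfolding B.scaleR by (intro tendsto_intros x)
    then show "r *\<^sub>R f \<in> completion_carrier" by (rule completion_carrierI)
  qed
qed

definition polar :: "'a :: real_normed_vector \<Rightarrow> 'a \<Rightarrow> real" where
  "polar f g = ((norm (f + g))\<^sup>2 - (norm (f - g))\<^sup>2) / 4"

lemma tendsto_polar:
  assumes "f \<longlonglongrightarrow> a" "g \<longlonglongrightarrow> b"
  shows "(\<lambda>n. polar (f n) (g n)) \<longlonglongrightarrow> polar a b"
  unfolding polar_def by (intro tendsto_intros assms) simp

lemma polar_blinfun_inner_right:
  "polar (blinfun_inner_right x) (blinfun_inner_right y) = x \<bullet> (y :: 'a :: real_inner)"
proof -
  interpret B: bounded_linear "blinfun_inner_right :: 'a \<Rightarrow> 'a \<Rightarrow>\<^sub>L real"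
    by (rule bounded_linear_blinfun_inner_right)
  show ?thesis
    by (simp add: polar_def B.add[symmetric] B.diff[symmetric] norm_blinfun_inner_right
        power2_norm_eq_inner inner_add_left inner_add_right inner_diff_left inner_diff_right
        inner_commute)
qed

lemma polar_add_left:
  fixes f g h :: "'a :: real_inner \<Rightarrow>\<^sub>L real"
  assumes "f \<in> completion_carrier" "g \<in> completion_carrier" "h \<in> completion_carrier"
  shows "polar (f + g) h = polar f h + polar g h"
proof -
  interpret B: bounded_linear "blinfun_inner_right :: 'a \<Rightarrow> 'a \<Rightarrow>\<^sub>L real"
    by (rule bounded_linear_blinfun_inner_right)
  obtain x where x: "(\<lambda>n. blinfun_inner_right (x n)) \<longlonglongrightarrow> f"
    using completion_carrier_limit[OF assms(1)] .
  obtain y where y: "(\<lambda>n. blinfun_inner_right (y n)) \<longlonglongrightarrow> g"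
    using completion_carrier_limit[OF assms(2)] .
  obtain z where z: "(\<lambda>n. blinfun_inner_right (z n)) \<longlonglongrightarrow> h"
    using completion_carrier_limit[OF assms(3)] .
  show ?thesis
  proof (rule LIMSEQ_unique)
    show "(\<lambda>n. polar (blinfun_inner_right (x n) + blinfun_inner_right (y n))
             (blinfun_inner_right (z n))) \<longlonglongrightarrow> polar (f + g) h"
      by (intro tendsto_polar tendsto_add x y z)
    have "(\<lambda>n. polar (blinfun_inner_right (x n)) (blinfun_inner_right (z n)) +
             polar (blinfun_inner_right (y n)) (blinfun_inner_right (z n)))
             \<longlonglongrightarrow> polar f h + polar g h"
      by (intro tendsto_polar tendsto_add x y z)
    then show "(\<lambda>n. polar (blinfun_inner_right (x n) + blinfun_inner_right (y n))
             (blinfun_inner_right (z n))) \<longlonglongrightarrow> polar f h + polar g h"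
      by (simp add: B.add[symmetric] polar_blinfun_inner_right inner_add_left)
  qed
qed

lemma polar_scaleR_left:
  fixes f g :: "'a :: real_inner \<Rightarrow>\<^sub>L real"
  assumes "f \<in> completion_carrier" "g \<in> completion_carrier"
  shows "polar (r *\<^sub>R f) g = r * polar f g"
proof -
  interpret B: bounded_linear "blinfun_inner_right :: 'a \<Rightarrow> 'a \<Rightarrow>\<^sub>L real"
    by (rule bounded_linear_blinfun_inner_right)
  obtain x where x: "(\<lambda>n. blinfun_inner_right (x n)) \<longlonglongrightarrow> f"
    using completion_carrier_limit[OF assms(1)] .
  obtain y where y: "(\<lambda>n. blinfun_inner_right (y n)) \<longlonglongrightarrow> g"
    using completion_carrier_limit[OF assms(2)] .
  show ?thesis
  proof (rule LIMSEQ_unique)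
    show "(\<lambda>n. polar (r *\<^sub>R blinfun_inner_right (x n)) (blinfun_inner_right (y n)))
            \<longlonglongrightarrow> polar (r *\<^sub>R f) g"
      by (intro tendsto_polar tendsto_intros x y)
    have "(\<lambda>n. r * polar (blinfun_inner_right (x n)) (blinfun_inner_right (y n)))
            \<longlonglongrightarrow> r * polar f g"
      by (intro tendsto_polar tendsto_intros x y)
    then show "(\<lambda>n. polar (r *\<^sub>R blinfun_inner_right (x n)) (blinfun_inner_right (y n)))
            \<longlonglongrightarrow> r * polar f g"
      by (simp add: B.scaleR[symmetric] polar_blinfun_inner_right)
  qed
qed

lemma polar_commute: "polar f g = polar g f"
  by (simp add: polar_def add.commute norm_minus_commute)

lemma polar_self: "polar f f = (norm f)\<^sup>2"
proof -
  have "f + f = 2 *\<^sub>R f" by (simp add: scaleR_2)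
  then show ?thesis by (simp add: polar_def power_mult_distrib)
qed

lift_definition blinfun_scaleC :: "complex \<Rightarrow> 'a :: complex_inner \<Rightarrow>\<^sub>L 'a" is "scaleC"
  by (rule bounded_linear_scaleC)

lemma blinfun_inner_right_scaleC:
  "blinfun_inner_right x o\<^sub>L blinfun_scaleC c = blinfun_inner_right (cnj c *\<^sub>C x)"
  by (rule blinfun_eqI) (simp add: blinfun_scaleC.rep_eq inner_scaleC_left)

lemma completion_carrier_scaleC:
  fixes f :: "'a :: complex_inner \<Rightarrow>\<^sub>L real"
  assumes "f \<in> completion_carrier"
  shows "f o\<^sub>L blinfun_scaleC c \<in> completion_carrier"
proof -
  obtain x where x: "(\<lambda>n. blinfun_inner_right (x n)) \<longlonglongrightarrow> f"
    using completion_carrier_limit[OF assms] .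
  have "(\<lambda>n. blinfun_inner_right (x n) o\<^sub>L blinfun_scaleC c) \<longlonglongrightarrow> (f o\<^sub>L blinfun_scaleC c)"
    by (intro tendsto_intros x)
  then have "(\<lambda>n. blinfun_inner_right (cnj c *\<^sub>C x n)) \<longlonglongrightarrow> (f o\<^sub>L blinfun_scaleC c)"
    by (simp only: blinfun_inner_right_scaleC)
  then show ?thesis by (rule completion_carrierI)
qed

lemma polar_scaleC:
  fixes f g :: "'a :: complex_inner \<Rightarrow>\<^sub>L real"
  assumes "f \<in> completion_carrier" "g \<in> completion_carrier"
  shows "polar (f o\<^sub>L blinfun_scaleC c) g = polar f (g o\<^sub>L blinfun_scaleC (cnj c))"
proof -
  obtain x where x: "(\<lambda>n. blinfun_inner_right (x n)) \<longlonglongrightarrow> f"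
    using completion_carrier_limit[OF assms(1)] .
  obtain y where y: "(\<lambda>n. blinfun_inner_right (y n)) \<longlonglongrightarrow> g"
    using completion_carrier_limit[OF assms(2)] .
  show ?thesis
  proof (rule LIMSEQ_unique)
    show "(\<lambda>n. polar (blinfun_inner_right (x n) o\<^sub>L blinfun_scaleC c) (blinfun_inner_right (y n)))
            \<longlonglongrightarrow> polar (f o\<^sub>L blinfun_scaleC c) g"
      by (intro tendsto_polar tendsto_intros x y)
    have "(\<lambda>n. polar (blinfun_inner_right (x n)) (blinfun_inner_right (y n) o\<^sub>L blinfun_scaleC (cnj c)))
            \<longlonglongrightarrow> polar f (g o\<^sub>L blinfun_scaleC (cnj c))"
      by (intro tendsto_polar tendsto_intros x y)
    then show "(\<lambda>n. polar (blinfun_inner_right (x n) o\<^sub>L blinfun_scaleC c) (blinfun_inner_right (y n)))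
            \<longlonglongrightarrow> polar f (g o\<^sub>L blinfun_scaleC (cnj c))"
      by (simp only: blinfun_inner_right_scaleC polar_blinfun_inner_right inner_scaleC_left)
  qed
qed

typedef (overloaded) 'a completion = "completion_carrier :: ('a :: real_inner \<Rightarrow>\<^sub>L real) set"
  using subspace_0[OF subspace_completion_carrier] by blast

setup_lifting type_definition_completion

instantiation completion :: (real_inner) real_inner
begin

lift_definition zero_completion :: "'a completion" is 0
  by (rule subspace_0[OF subspace_completion_carrier])

lift_definition plus_completion :: "'a completion \<Rightarrow> 'a completion \<Rightarrow> 'a completion" is "(+)"
  by (rule subspace_add[OF subspace_completion_carrier])

lift_definition minus_completion :: "'a completion \<Rightarrow> 'a completion \<Rightarrow> 'a completion" is "(-)"
  by (rule subspace_diff[OF subspace_completion_carrier])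

lift_definition uminus_completion :: "'a completion \<Rightarrow> 'a completion" is uminus
  by (rule subspace_neg[OF subspace_completion_carrier])

lift_definition scaleR_completion :: "real \<Rightarrow> 'a completion \<Rightarrow> 'a completion" is scaleR
  by (rule subspace_scale[OF subspace_completion_carrier])

lift_definition inner_completion :: "'a completion \<Rightarrow> 'a completion \<Rightarrow> real" is polar .

lift_definition norm_completion :: "'a completion \<Rightarrow> real" is norm .

definition sgn_completion :: "'a completion \<Rightarrow> 'a completion" where
  "sgn_completion x = inverse (norm x) *\<^sub>R x"

definition dist_completion :: "'a completion \<Rightarrow> 'a completion \<Rightarrow> real" where
  "dist_completion x y = norm (x - y)"

definition uniformity_completion :: "('a completion \<times> 'a completion) filter" where
  "uniformity_completion = (INF e\<in>{0 <..}. principal {(x, y). dist x y < e})"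

definition open_completion :: "'a completion set \<Rightarrow> bool" where
  "open_completion S = (\<forall>x\<in>S. \<forall>\<^sub>F (x', y) in uniformity. x' = x \<longrightarrow> y \<in> S)"

instance
proof
  fix x y z :: "'a completion" and r s :: real
  show "x + y + z = x + (y + z)" by transfer (simp add: add.assoc)
  show "x + y = y + x" by transfer (simp add: add.commute)
  show "0 + x = x" by transfer simp
  show "- x + x = 0" by transfer simp
  show "x - y = x + - y" by transfer simp
  show "r *\<^sub>R (x + y) = r *\<^sub>R x + r *\<^sub>R y" by transfer (simp add: scaleR_add_right)
  show "(r + s) *\<^sub>R x = r *\<^sub>R x + s *\<^sub>R x" by transfer (simp add: scaleR_add_left)
  show "r *\<^sub>R s *\<^sub>R x = (r * s) *\<^sub>R x" by transfer simp
  show "1 *\<^sub>R x = x" by transfer simp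
  show "sgn x = inverse (norm x) *\<^sub>R x" by (rule sgn_completion_def)
  show "dist x y = norm (x - y)" by (rule dist_completion_def)
  show "x \<bullet> y = y \<bullet> x" by transfer (rule polar_commute)
  show "(x + y) \<bullet> z = x \<bullet> z + y \<bullet> z" by transfer (rule polar_add_left)
  show "(r *\<^sub>R x) \<bullet> y = r * (x \<bullet> y)" by transfer (rule polar_scaleR_left)
  show "0 \<le> x \<bullet> x" by transfer (simp add: polar_self)
  show "x \<bullet> x = 0 \<longleftrightarrow> x = 0" by transfer (simp add: polar_self)
  show "norm x = sqrt (x \<bullet> x)" by transfer (simp add: polar_self)
qed (simp_all add: uniformity_completion_def open_completion_def)

end

lemma norm_Rep_completion: "norm (Rep_completion x) = norm x"
  by transfer simp

lemma dist_Rep_completion: "dist (Rep_completion x) (Rep_completion y) = dist x y"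
  unfolding dist_norm by transfer simp

instance completion :: (real_inner) complete_space
proof
  fix X :: "nat \<Rightarrow> 'a completion"
  assume "Cauchy X"
  then have "Cauchy (\<lambda>n. Rep_completion (X n))"
    by (simp add: Cauchy_def dist_Rep_completion)
  then obtain f where f: "(\<lambda>n. Rep_completion (X n)) \<longlonglongrightarrow> f"
    using Cauchy_convergent convergent_def by blast
  have "f \<in> completion_carrier"
    using closed_sequentially[OF _ _ f, of completion_carrier] Rep_completion
    by (auto simp: completion_carrier_def)
  then have "X \<longlonglongrightarrow> Abs_completion f"
    using f by (simp add: LIMSEQ_def dist_Rep_completion[symmetric] Abs_completion_inverse)
  then show "convergent X" by (auto simp: convergent_def)
qed

lift_definition to_completion :: "'a :: real_inner \<Rightarrow> 'a completion" is blinfun_inner_right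
  unfolding completion_carrier_def by (rule subsetD[OF closure_subset]) simp

lemma inner_to_completion: "to_completion x \<bullet> to_completion y = x \<bullet> y"
  by transfer (rule polar_blinfun_inner_right)

lemma dense_range_to_completion: "closure (range (to_completion :: 'a :: real_inner \<Rightarrow> _)) = UNIV"
proof -
  have "h \<in> closure (range (to_completion :: 'a \<Rightarrow> _))" for h :: "'a completion"
  proof -
    obtain x where x: "(\<lambda>n. blinfun_inner_right (x n)) \<longlonglongrightarrow> Rep_completion h"
      using completion_carrier_limit[OF Rep_completion] .
    then have "(\<lambda>n. to_completion (x n)) \<longlonglongrightarrow> h"
      by (simp add: LIMSEQ_def dist_Rep_completion[symmetric] to_completion.rep_eq)
    then show ?thesis
      unfolding closure_sequential by (intro exI[of _ "\<lambda>n. to_completion (x n)"]) simp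
  qed
  then show ?thesis by blast
qed

instantiation completion :: (complex_inner) complex_inner
begin

lift_definition scaleC_completion :: "complex \<Rightarrow> 'a completion \<Rightarrow> 'a completion"
  is "\<lambda>c f. f o\<^sub>L blinfun_scaleC (cnj c)"
  by (rule completion_carrier_scaleC)

definition cinner_completion :: "'a completion \<Rightarrow> 'a completion \<Rightarrow> complex" where
  "cinner_completion x y = Complex (x \<bullet> y) ((\<i> *\<^sub>C x) \<bullet> y)"

instance
proof
  fix x y z :: "'a completion" and a b :: complex and r :: real
  show right: "a *\<^sub>C (x + y) = a *\<^sub>C x + a *\<^sub>C y" for a and x y :: "'a completion"
    by transfer (rule blinfun_eqI, simp add: blinfun.add_left)
  show left: "(a + b) *\<^sub>C x = a *\<^sub>C x + b *\<^sub>C x" for a b and x :: "'a completion"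
    by transfer (rule blinfun_eqI,
        simp add: blinfun_scaleC.rep_eq scaleC_add_left blinfun.add_right blinfun.add_left)
  show assoc: "a *\<^sub>C b *\<^sub>C x = (a * b) *\<^sub>C x" for a b and x :: "'a completion"
    by transfer (rule blinfun_eqI,
        simp add: blinfun_scaleC.rep_eq scaleC_scaleC mult.commute)
  show real: "complex_of_real r *\<^sub>C x = r *\<^sub>R x" for r and x :: "'a completion"
    by transfer (rule blinfun_eqI,
        simp add: blinfun_scaleC.rep_eq scaleC_of_real blinfun.scaleR_right blinfun.scaleR_left)
  have adj: "(a *\<^sub>C x) \<bullet> y = x \<bullet> (cnj a *\<^sub>C y)" for a and x y :: "'a completion"
    by transfer (simp add: polar_scaleC)
  have neg: "(- a) *\<^sub>C x = - (a *\<^sub>C x)" for a and x :: "'a completion"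
    using assoc[of "-1" a x] real[of "-1" "a *\<^sub>C x"] by simp
  show "cinner x y = cnj (cinner y x)"
    using adj[of "\<i>" y x] by (simp add: cinner_completion_def complex_eq_iff adj neg inner_commute)
  show "cinner x (y + z) = cinner x y + cinner x z"
    by (simp add: cinner_completion_def complex_eq_iff inner_add_right)
  have "a *\<^sub>C y = complex_of_real (Re a) *\<^sub>C y + complex_of_real (Im a) *\<^sub>C \<i> *\<^sub>C y"
    by (simp add: assoc left[symmetric] mult.commute[of _ \<i>] flip: complex_eq)
  then have decomp: "a *\<^sub>C y = Re a *\<^sub>R y + Im a *\<^sub>R (\<i> *\<^sub>C y)"
    by (simp add: real)
  have unit: "(\<i> *\<^sub>C x) \<bullet> (\<i> *\<^sub>C y) = x \<bullet> y"
    using real[of 1 y] by (simp add: adj assoc)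
  have "(\<i> *\<^sub>C x) \<bullet> y = - (x \<bullet> (\<i> *\<^sub>C y))"
    by (simp add: adj neg)
  then show "cinner x (a *\<^sub>C y) = a * cinner x y"
    by (simp add: cinner_completion_def complex_eq_iff decomp inner_add_right unit)
  show "x \<bullet> y = Re (cinner x y)"
    by (simp add: cinner_completion_def)
qed

end

instance completion :: (complex_inner) chilbert_space ..


section \<open>The tower of matrix algebras\<close>

text \<open>
  The index type \<open>'n\<close> has \<open>n\<close> elements. An element of \<open>M\<^sub>n\<^bsup>\<otimes>k\<^esup>\<close> is a matrix whose rows and columns
  are indexed by words of length \<open>k\<close> over \<open>'n\<close>; entries at other words are irrelevant.
\<close>

type_synonym 'n wmat = "'n list \<Rightarrow> 'n list \<Rightarrow> complex"

definition words :: "nat \<Rightarrow> 'n list set" where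
  "words k = {w. length w = k}"

definition wmult :: "nat \<Rightarrow> 'n wmat \<Rightarrow> 'n wmat \<Rightarrow> 'n wmat" where
  "wmult k a b = (\<lambda>s t. \<Sum>r\<in>words k. a s r * b r t)"

definition wadj :: "'n wmat \<Rightarrow> 'n wmat" where
  "wadj a = (\<lambda>s t. cnj (a t s))"

text \<open>The identity of \<open>M\<^sub>n\<^bsup>\<otimes>k\<^esup>\<close>, simultaneously for every \<open>k\<close>.\<close>

definition wid :: "'n wmat" where
  "wid = (\<lambda>s t. if s = t then 1 else 0)"

text \<open>\<open>a \<otimes> b\<close> for \<open>a \<in> M\<^sub>n\<^bsup>\<otimes>k\<^esup>\<close>; the first \<open>k\<close> letters of a word belong to \<open>a\<close>.\<close>

definition wtensor :: "nat \<Rightarrow> 'n wmat \<Rightarrow> 'n wmat \<Rightarrow> 'n wmat" where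
  "wtensor k a b = (\<lambda>s t. a (take k s) (take k t) * b (drop k s) (drop k t))"

definition wtrace :: "nat \<Rightarrow> ('n :: finite) wmat \<Rightarrow> complex" where
  "wtrace k a = (\<Sum>w\<in>words k. a w w) / of_nat (CARD('n) ^ k)"

text \<open>
  The union of the tower under \<open>x \<mapsto> x \<otimes> 1\<close> is realized by matrices indexed by infinite words:
  \<open>a \<in> M\<^sub>n\<^bsup>\<otimes>k\<^esup>\<close> becomes \<open>a \<otimes> 1 \<otimes> 1 \<otimes> \<dots>\<close>, so that the connecting maps become inclusions
  (\<open>wmat_kernel_tensor\<close>).
\<close>

definition wmat_kernel :: "nat \<Rightarrow> 'n wmat \<Rightarrow> (nat \<Rightarrow> 'n) \<Rightarrow> (nat \<Rightarrow> 'n) \<Rightarrow> complex" where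
  "wmat_kernel k a =
     (\<lambda>s t. if \<forall>i\<ge>k. s i = t i then a (map s [0..<k]) (map t [0..<k]) else 0)"

lemma wmat_kernel_tensor: "wmat_kernel (k + m) (wtensor k a wid) = wmat_kernel k a"
proof (intro ext)
  fix s t :: "nat \<Rightarrow> 'a"
  have "(\<forall>i\<ge>k. s i = t i) \<longleftrightarrow> (\<forall>i\<ge>k+m. s i = t i) \<and> (\<forall>i\<in>{k..<k+m}. s i = t i)"
    by (metis atLeastLessThan_iff le_add1 le_trans not_le_imp_less)
  moreover have "map s [k..<k+m] = map t [k..<k+m] \<longleftrightarrow> (\<forall>i\<in>{k..<k+m}. s i = t i)"
    by simp
  ultimately show "wmat_kernel (k + m) (wtensor k a wid) s t = wmat_kernel k a s t"
    by (auto simp: wmat_kernel_def wtensor_def wid_def take_map drop_map)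
qed

typedef 'n uhf = "{x :: (nat \<Rightarrow> 'n) \<Rightarrow> (nat \<Rightarrow> 'n) \<Rightarrow> complex. \<exists>k a. x = wmat_kernel k a}"
  by blast

setup_lifting type_definition_uhf

lift_definition of_wmat :: "nat \<Rightarrow> 'n wmat \<Rightarrow> 'n uhf" is wmat_kernel
  by blast

lemma of_wmat_tensor: "of_wmat (k + m) (wtensor k a wid) = of_wmat k a"
  by transfer (rule wmat_kernel_tensor)

lemma of_wmat_mono: "k \<le> l \<Longrightarrow> \<exists>b. of_wmat k a = of_wmat l b"
  using of_wmat_tensor[of k "l - k" a] by (metis le_add_diff_inverse)

lemma uhf_exhaust: "\<exists>k a. x = of_wmat k a"
  by transfer blast

lemma uhf_exhaust3: "\<exists>k a b c. x = of_wmat k a \<and> y = of_wmat k b \<and> z = of_wmat k c"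
proof -
  obtain k1 a1 k2 a2 k3 a3 where *: "x = of_wmat k1 a1" "y = of_wmat k2 a2" "z = of_wmat k3 a3"
    by (metis uhf_exhaust)
  show ?thesis
    unfolding * using of_wmat_mono[of k1 "max k1 (max k2 k3)" a1]
      of_wmat_mono[of k2 "max k1 (max k2 k3)" a2] of_wmat_mono[of k3 "max k1 (max k2 k3)" a3]
    by (metis max.cobounded1 max.cobounded2 max.coboundedI2)
qed

lemma wmat_kernel_exhaust2:
  assumes "\<exists>k a. x = wmat_kernel k a" "\<exists>k a. y = wmat_kernel k a"
  obtains k a b where "x = wmat_kernel k a" "y = wmat_kernel k b"
proof -
  obtain k a l b where *: "x = wmat_kernel k a" "y = wmat_kernel l b"
    using assms by blast
  have "x = wmat_kernel (k + l) (wtensor k a wid)" "y = wmat_kernel (k + l) (wtensor l b wid)"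
    using wmat_kernel_tensor[of k l a] wmat_kernel_tensor[of l k b] *
    by (simp_all add: add.commute)
  then show ?thesis by (rule that)
qed

lemma finite_words [simp]: "finite (words k :: ('n :: finite) list set)"
  using finite_lists_length_eq[of "UNIV :: 'n set" k] by (simp add: words_def)

lemma card_words: "card (words k :: ('n :: finite) list set) = CARD('n) ^ k"
  using card_lists_length_eq[of "UNIV :: 'n set" k] by (simp add: words_def)

lemma sum_words_add:
  "(\<Sum>w\<in>words (k + m). f w) = (\<Sum>p\<in>words k. \<Sum>q\<in>words m. f (p @ q))"
proof -
  have "(\<Sum>w\<in>words (k + m). f w) = (\<Sum>(p, q)\<in>words k \<times> words m. f (p @ q))"
    by (rule sum.reindex_bij_witness[of _ "\<lambda>(p, q). p @ q" "\<lambda>w. (take k w, drop k w)"])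
       (auto simp: words_def)
  then show ?thesis by (simp add: sum.cartesian_product)
qed

lemma wmat_kernel_mult:
  fixes a b :: "('n :: finite) wmat"
  shows "(\<Sum>r | wmat_kernel k a s r \<noteq> 0. wmat_kernel k a s r * wmat_kernel k b r t)
       = wmat_kernel k (wmult k a b) s t"
proof -
  define R where "R = {r. \<forall>i\<ge>k. s i = r i}"
  define P where "P \<longleftrightarrow> (\<forall>i\<ge>k. s i = t i)"
  define g where "g w = (\<lambda>i. if i < k then w ! i else s i)" for w
  have bij: "bij_betw (\<lambda>r. map r [0..<k]) R (words k)"
    by (rule bij_betwI[where g = g])
       (auto simp: R_def g_def words_def fun_eq_iff intro!: nth_equalityI)
  then have fin: "finite R"
    by (metis bij_betw_finite finite_words)
  have "(\<Sum>r | wmat_kernel k a s r \<noteq> 0. wmat_kernel k a s r * wmat_kernel k b r t)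
      = (\<Sum>r\<in>R. wmat_kernel k a s r * wmat_kernel k b r t)"
    by (rule sum.mono_neutral_left[OF fin]) (auto simp: R_def wmat_kernel_def)
  also have "\<dots> = (\<Sum>r\<in>R. if P
      then a (map s [0..<k]) (map r [0..<k]) * b (map r [0..<k]) (map t [0..<k]) else 0)"
    by (rule sum.cong[OF refl]) (auto simp: R_def P_def wmat_kernel_def)
  also have "\<dots> = wmat_kernel k (wmult k a b) s t"
    using sum.reindex_bij_betw[OF bij, of "\<lambda>r. a (map s [0..<k]) r * b r (map t [0..<k])"]
    by (cases P) (simp_all add: wmat_kernel_def wmult_def flip: P_def)
  finally show ?thesis .
qed

lemma wmat_kernel_inject:
  assumes "wmat_kernel k a = wmat_kernel k b" "v \<in> words k" "w \<in> words k"
  shows "a v w = b v w"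
proof -
  define g where "g x = (\<lambda>i. if i < k then x ! i else undefined)" for x :: "'a list"
  have "map (g x) [0..<k] = x" if "x \<in> words k" for x
    using that by (auto simp: g_def words_def intro: nth_equalityI)
  moreover have "wmat_kernel k a (g v) (g w) = wmat_kernel k b (g v) (g w)"
    using assms(1) by simp
  ultimately show ?thesis
    using assms(2,3) by (simp add: wmat_kernel_def) (simp add: g_def)
qed

lemma wmat_kernel_cong:
  "(\<And>v w. v \<in> words k \<Longrightarrow> w \<in> words k \<Longrightarrow> a v w = b v w) \<Longrightarrow> wmat_kernel k a = wmat_kernel k b"
  by (auto simp: wmat_kernel_def words_def fun_eq_iff)

lift_definition uadj :: "'n uhf \<Rightarrow> 'n uhf" is "\<lambda>x s t. cnj (x t s)"
proof -
  fix x :: "(nat \<Rightarrow> 'n) \<Rightarrow> (nat \<Rightarrow> 'n) \<Rightarrow> complex"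
  assume "\<exists>k a. x = wmat_kernel k a"
  then obtain k a where "x = wmat_kernel k a" by blast
  then have "(\<lambda>s t. cnj (x t s)) = wmat_kernel k (wadj a)"
    by (auto simp: wmat_kernel_def wadj_def fun_eq_iff)
  then show "\<exists>k a. (\<lambda>s t. cnj (x t s)) = wmat_kernel k a" by blast
qed

lemma uadj_of_wmat: "uadj (of_wmat k a) = of_wmat k (wadj a)"
  by transfer (auto simp: wmat_kernel_def wadj_def fun_eq_iff)

instantiation uhf :: (finite) times
begin

text \<open>For fixed \<open>s\<close> only finitely many entries \<open>x s r\<close> are nonzero.\<close>

lift_definition times_uhf :: "'a uhf \<Rightarrow> 'a uhf \<Rightarrow> 'a uhf"
  is "\<lambda>x y s t. \<Sum>r | x s r \<noteq> 0. x s r * y r t"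
proof -
  fix x y :: "(nat \<Rightarrow> 'a) \<Rightarrow> (nat \<Rightarrow> 'a) \<Rightarrow> complex"
  assume "\<exists>k a. x = wmat_kernel k a" "\<exists>k a. y = wmat_kernel k a"
  then obtain k a b where "x = wmat_kernel k a" "y = wmat_kernel k b"
    by (rule wmat_kernel_exhaust2)
  then have "(\<lambda>s t. \<Sum>r | x s r \<noteq> 0. x s r * y r t) = wmat_kernel k (wmult k a b)"
    by (simp add: wmat_kernel_mult fun_eq_iff)
  then show "\<exists>k a. (\<lambda>s t. \<Sum>r | x s r \<noteq> 0. x s r * y r t) = wmat_kernel k a" by blast
qed

instance ..

end

lemma times_of_wmat: "of_wmat k a * of_wmat k b = of_wmat k (wmult k a b)"
  by transfer (simp add: wmat_kernel_mult fun_eq_iff)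

text \<open>The value does not depend on the level \<open>k\<close> (\<open>utrace_of_wmat\<close>).\<close>

definition utrace :: "('n :: finite) uhf \<Rightarrow> complex" where
  "utrace x = (THE c. \<exists>k a. x = of_wmat k a \<and> c = wtrace k a)"

lemma wtrace_tensor: "wtrace (k + m) (wtensor k a wid) = wtrace k (a :: ('n :: finite) wmat)"
proof -
  have "(\<Sum>w\<in>words (k + m). wtensor k a wid w w)
      = (\<Sum>p\<in>words k. \<Sum>q\<in>words m. wtensor k a wid (p @ q) (p @ q))"
    by (rule sum_words_add)
  also have "\<dots> = (\<Sum>p\<in>words k. \<Sum>q\<in>(words m :: 'n list set). a p p)"
    by (intro sum.cong refl) (auto simp: wtensor_def wid_def words_def)
  also have "\<dots> = of_nat (CARD('n) ^ m) * (\<Sum>p\<in>words k. a p p)"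
    by (simp add: card_words sum_distrib_left)
  finally show ?thesis
    by (simp add: wtrace_def power_add)
qed

lemma utrace_of_wmat: "utrace (of_wmat k a) = wtrace k a"
  unfolding utrace_def
proof (rule the_equality)
  show "\<exists>k' a'. of_wmat k a = of_wmat k' a' \<and> wtrace k a = wtrace k' a'" by blast
next
  fix c
  assume "\<exists>l b. of_wmat k a = of_wmat l b \<and> c = wtrace l b"
  then obtain l b where eq: "of_wmat k a = of_wmat l b" and c: "c = wtrace l b" by blast
  let ?a = "wtensor k a wid" and ?b = "wtensor l b wid"
  have "of_wmat (k + l) ?a = of_wmat (k + l) ?b"
    using of_wmat_tensor[of k l a] of_wmat_tensor[of l k b] eq by (simp add: add.commute)
  then have "?a w w = ?b w w" if "w \<in> words (k + l)" for w
    using wmat_kernel_inject[of "k + l" ?a ?b w w] that by (metis of_wmat.rep_eq)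
  then have "wtrace (k + l) ?a = wtrace (k + l) ?b"
    by (simp add: wtrace_def)
  then show "c = wtrace k a"
    using wtrace_tensor[of k l a] wtrace_tensor[of l k b] c by (simp add: add.commute)
qed

lemma utrace_adj_times:
  "utrace (uadj (of_wmat k a) * of_wmat k b)
     = (\<Sum>s\<in>words k. \<Sum>t\<in>words k. cnj (a s t) * b s t) / of_nat (CARD('n) ^ k)"
  for a b :: "('n :: finite) wmat"
  using sum.swap[of "\<lambda>s t. cnj (a s t) * b s t" "words k" "words k"]
  by (simp add: uadj_of_wmat times_of_wmat utrace_of_wmat wtrace_def wmult_def wadj_def)

text \<open>The inner product of the GNS construction is \<open>\<langle>x, y\<rangle> = \<tau>(x\<^sup>* y)\<close>.\<close>

instantiation uhf :: (finite) complex_inner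
begin

lift_definition zero_uhf :: "'a uhf" is "\<lambda>s t. 0"
proof -
  have "(\<lambda>s t. 0) = wmat_kernel 0 (\<lambda>s t :: 'a list. 0)"
    by (simp add: wmat_kernel_def fun_eq_iff)
  then show "\<exists>k a. (\<lambda>s t :: nat \<Rightarrow> 'a. 0) = wmat_kernel k a" by blast
qed

lift_definition plus_uhf :: "'a uhf \<Rightarrow> 'a uhf \<Rightarrow> 'a uhf" is "\<lambda>x y s t. x s t + y s t"
proof -
  fix x y :: "(nat \<Rightarrow> 'a) \<Rightarrow> (nat \<Rightarrow> 'a) \<Rightarrow> complex"
  assume "\<exists>k a. x = wmat_kernel k a" "\<exists>k a. y = wmat_kernel k a"
  then obtain k a b where "x = wmat_kernel k a" "y = wmat_kernel k b"
    by (rule wmat_kernel_exhaust2)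
  then have "(\<lambda>s t. x s t + y s t) = wmat_kernel k (\<lambda>s t. a s t + b s t)"
    by (auto simp: wmat_kernel_def fun_eq_iff)
  then show "\<exists>k a. (\<lambda>s t. x s t + y s t) = wmat_kernel k a" by blast
qed

lift_definition scaleC_uhf :: "complex \<Rightarrow> 'a uhf \<Rightarrow> 'a uhf" is "\<lambda>c x s t. c * x s t"
proof -
  fix c and x :: "(nat \<Rightarrow> 'a) \<Rightarrow> (nat \<Rightarrow> 'a) \<Rightarrow> complex"
  assume "\<exists>k a. x = wmat_kernel k a"
  then obtain k a where "x = wmat_kernel k a" by blast
  then have "(\<lambda>s t. c * x s t) = wmat_kernel k (\<lambda>s t. c * a s t)"
    by (auto simp: wmat_kernel_def fun_eq_iff)
  then show "\<exists>k a. (\<lambda>s t. c * x s t) = wmat_kernel k a" by blast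
qed

definition uminus_uhf :: "'a uhf \<Rightarrow> 'a uhf" where
  "uminus_uhf x = (- 1) *\<^sub>C x"

definition minus_uhf :: "'a uhf \<Rightarrow> 'a uhf \<Rightarrow> 'a uhf" where
  "minus_uhf x y = x + - y"

definition scaleR_uhf :: "real \<Rightarrow> 'a uhf \<Rightarrow> 'a uhf" where
  "scaleR_uhf r x = complex_of_real r *\<^sub>C x"

definition cinner_uhf :: "'a uhf \<Rightarrow> 'a uhf \<Rightarrow> complex" where
  "cinner_uhf x y = utrace (uadj x * y)"

definition inner_uhf :: "'a uhf \<Rightarrow> 'a uhf \<Rightarrow> real" where
  "inner_uhf x y = Re (cinner x y)"

definition norm_uhf :: "'a uhf \<Rightarrow> real" where
  "norm_uhf x = sqrt (x \<bullet> x)"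

definition sgn_uhf :: "'a uhf \<Rightarrow> 'a uhf" where
  "sgn_uhf x = inverse (norm x) *\<^sub>R x"

definition dist_uhf :: "'a uhf \<Rightarrow> 'a uhf \<Rightarrow> real" where
  "dist_uhf x y = norm (x - y)"

definition uniformity_uhf :: "('a uhf \<times> 'a uhf) filter" where
  "uniformity_uhf = (INF e\<in>{0 <..}. principal {(x, y). dist x y < e})"

definition open_uhf :: "'a uhf set \<Rightarrow> bool" where
  "open_uhf S = (\<forall>x\<in>S. \<forall>\<^sub>F (x', y) in uniformity. x' = x \<longrightarrow> y \<in> S)"

lemma plus_of_wmat: "of_wmat k a + of_wmat k b = (of_wmat k (\<lambda>s t. a s t + b s t) :: 'a uhf)"
  by transfer (auto simp: wmat_kernel_def fun_eq_iff)

lemma scaleC_of_wmat: "c *\<^sub>C of_wmat k a = (of_wmat k (\<lambda>s t. c * a s t) :: 'a uhf)"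
  by transfer (auto simp: wmat_kernel_def fun_eq_iff)

lemma cinner_of_wmat:
  "cinner (of_wmat k a :: 'a uhf) (of_wmat k b)
     = (\<Sum>s\<in>words k. \<Sum>t\<in>words k. cnj (a s t) * b s t) / of_nat (CARD('a) ^ k)"
  by (simp add: cinner_uhf_def utrace_adj_times)

lemma inner_of_wmat_self:
  "(of_wmat k a :: 'a uhf) \<bullet> of_wmat k a
     = (\<Sum>s\<in>words k. \<Sum>t\<in>words k. (cmod (a s t))\<^sup>2) / real (CARD('a) ^ k)"
proof -
  have "cnj z * z = complex_of_real ((cmod z)\<^sup>2)" for z
    by (metis complex_norm_square mult.commute)
  then have "cinner (of_wmat k a :: 'a uhf) (of_wmat k a) = complex_of_real
      ((\<Sum>s\<in>words k. \<Sum>t\<in>words k. (cmod (a s t))\<^sup>2) / real (CARD('a) ^ k))"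
    by (simp add: cinner_of_wmat)
  then show ?thesis
    by (simp only: inner_uhf_def Re_complex_of_real)
qed

instance
proof
  fix x y z :: "'a uhf" and a b c :: complex and r s :: real
  show assoc: "x + y + z = x + (y + z)" by transfer (simp add: add.assoc)
  show comm: "x + y = y + x" by transfer (simp add: add.commute)
  show "0 + x = x" by transfer simp
  show "- x + x = 0" unfolding uminus_uhf_def by transfer simp
  show "x - y = x + - y" by (rule minus_uhf_def)
  show addR: "c *\<^sub>C (x + y) = c *\<^sub>C x + c *\<^sub>C y" for c and x y :: "'a uhf"
    by transfer (simp add: distrib_left)
  show addL: "(a + b) *\<^sub>C x = a *\<^sub>C x + b *\<^sub>C x" for a b and x :: "'a uhf"
    by transfer (simp add: distrib_right)
  show mulC: "a *\<^sub>C b *\<^sub>C x = (a * b) *\<^sub>C x" for a b and x :: "'a uhf"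
    by transfer (simp add: mult.assoc)
  show "complex_of_real r *\<^sub>C x = r *\<^sub>R x" by (simp add: scaleR_uhf_def)
  show "r *\<^sub>R (x + y) = r *\<^sub>R x + r *\<^sub>R y" by (simp add: scaleR_uhf_def addR)
  show "(r + s) *\<^sub>R x = r *\<^sub>R x + s *\<^sub>R x" by (simp add: scaleR_uhf_def addL)
  show "r *\<^sub>R s *\<^sub>R x = (r * s) *\<^sub>R x" by (simp add: scaleR_uhf_def mulC)
  show "1 *\<^sub>R x = x" unfolding scaleR_uhf_def by transfer simp
  show "sgn x = inverse (norm x) *\<^sub>R x" by (rule sgn_uhf_def)
  show "dist x y = norm (x - y)" by (rule dist_uhf_def)
  show "norm x = sqrt (x \<bullet> x)" by (rule norm_uhf_def)
  show "x \<bullet> y = Re (cinner x y)" by (rule inner_uhf_def)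
  obtain k p q w where pqw: "x = of_wmat k p" "y = of_wmat k q" "z = of_wmat k w"
    using uhf_exhaust3[of x y z] by blast
  show com: "cinner x y = cnj (cinner y x)"
    by (simp add: pqw cinner_of_wmat mult.commute)
  show "cinner x (y + z) = cinner x y + cinner x z"
    by (simp add: pqw cinner_of_wmat plus_of_wmat distrib_left sum.distrib add_divide_distrib)
  show "cinner x (a *\<^sub>C y) = a * cinner x y"
    by (simp add: pqw cinner_of_wmat scaleC_of_wmat sum_distrib_left mult.left_commute)
  show "x \<bullet> y = y \<bullet> x"
    using com by (simp add: inner_uhf_def)
  show "(x + y) \<bullet> z = x \<bullet> z + y \<bullet> z"
    by (simp add: inner_uhf_def pqw cinner_of_wmat plus_of_wmat distrib_right sum.distrib
        add_divide_distrib)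
  have "cinner (r *\<^sub>R x) y = complex_of_real r * cinner x y"
    by (simp add: pqw scaleR_uhf_def cinner_of_wmat scaleC_of_wmat sum_distrib_left mult.assoc)
  then show "(r *\<^sub>R x) \<bullet> y = r * (x \<bullet> y)"
    by (simp add: inner_uhf_def)
  show "0 \<le> x \<bullet> x"
    by (simp add: pqw inner_of_wmat_self sum_nonneg)
  show "x \<bullet> x = 0 \<longleftrightarrow> x = 0"
  proof
    assume "x \<bullet> x = 0"
    then have "(\<Sum>s\<in>words k. \<Sum>t\<in>words k. (cmod (p s t))\<^sup>2) = 0"
      by (simp add: pqw inner_of_wmat_self)
    then have "\<forall>s\<in>words k. \<forall>t\<in>words k. p s t = 0"
      by (simp add: sum_nonneg_eq_0_iff sum_nonneg)
    then have "wmat_kernel k p = wmat_kernel k (\<lambda>s t. 0)"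
      by (intro wmat_kernel_cong) simp
    then show "x = 0"
      unfolding pqw by transfer (auto simp: wmat_kernel_def fun_eq_iff)
  next
    assume "x = 0"
    then have "x = of_wmat 0 (\<lambda>s t. 0)"
      by transfer (auto simp: wmat_kernel_def fun_eq_iff)
    then show "x \<bullet> x = 0"
      by (simp add: inner_of_wmat_self)
  qed
qed (simp_all add: uniformity_uhf_def open_uhf_def)

end


section \<open>The GNS representation\<close>

type_synonym 'n gns = "'n uhf completion"

text \<open>Left multiplication, extended by continuity from the dense subspace (\<open>gns_rep_to_completion\<close>).\<close>

definition gns_rep :: "('n :: finite) uhf \<Rightarrow> 'n gns \<Rightarrow>\<^sub>L 'n gns" where
  "gns_rep a = (THE T. \<forall>x. blinfun_apply T (to_completion x) = to_completion (a * x))"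

lemma cmod_sum_mult_power2_le:
  "(cmod (\<Sum>i\<in>I. f i * g i))\<^sup>2 \<le> (\<Sum>i\<in>I. (cmod (f i))\<^sup>2) * (\<Sum>i\<in>I. (cmod (g i))\<^sup>2)"
proof -
  have "cmod (\<Sum>i\<in>I. f i * g i) \<le> (\<Sum>i\<in>I. cmod (f i) * cmod (g i))"
    by (rule order_trans[OF norm_sum]) (simp add: norm_mult)
  then have "(cmod (\<Sum>i\<in>I. f i * g i))\<^sup>2 \<le> (\<Sum>i\<in>I. cmod (f i) * cmod (g i))\<^sup>2"
    by (intro power_mono) simp_all
  also have "\<dots> \<le> (\<Sum>i\<in>I. (cmod (f i))\<^sup>2) * (\<Sum>i\<in>I. (cmod (g i))\<^sup>2)"
    by (rule Cauchy_Schwarz_ineq_sum)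
  finally show ?thesis .
qed

lemma wmult_tensor_bound:
  fixes a x :: "('n :: finite) wmat"
  shows "(\<Sum>s\<in>words (k + m). \<Sum>t\<in>words (k + m). (cmod (wmult (k + m) (wtensor k a wid) x s t))\<^sup>2)
    \<le> (\<Sum>p\<in>words k. \<Sum>p'\<in>words k. (cmod (a p p'))\<^sup>2)
      * (\<Sum>s\<in>words (k + m). \<Sum>t\<in>words (k + m). (cmod (x s t))\<^sup>2)"
proof -
  let ?A = "\<lambda>p. \<Sum>p'\<in>words k. (cmod (a p p'))\<^sup>2"
  let ?X = "\<lambda>q t. \<Sum>p'\<in>words k. (cmod (x (p' @ q) t))\<^sup>2"
  have entry: "wmult (k + m) (wtensor k a wid) x (p @ q) t = (\<Sum>p'\<in>words k. a p p' * x (p' @ q) t)"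
    if "p \<in> words k" "q \<in> words m" for p q t
  proof -
    have "wmult (k + m) (wtensor k a wid) x (p @ q) t
        = (\<Sum>p'\<in>words k. \<Sum>q'\<in>words m. wtensor k a wid (p @ q) (p' @ q') * x (p' @ q') t)"
      unfolding wmult_def by (rule sum_words_add)
    also have "\<dots> = (\<Sum>p'\<in>words k. \<Sum>q'\<in>words m. if q' = q then a p p' * x (p' @ q') t else 0)"
      using that by (intro sum.cong refl) (auto simp: wtensor_def wid_def words_def)
    also have "\<dots> = (\<Sum>p'\<in>words k. a p p' * x (p' @ q) t)"
      using that by (simp add: sum.delta)
    finally show ?thesis .
  qed
  have "(\<Sum>s\<in>words (k + m). \<Sum>t\<in>words (k + m). (cmod (wmult (k + m) (wtensor k a wid) x s t))\<^sup>2)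
      = (\<Sum>p\<in>words k. \<Sum>q\<in>words m. \<Sum>t\<in>words (k + m).
          (cmod (wmult (k + m) (wtensor k a wid) x (p @ q) t))\<^sup>2)"
    by (rule sum_words_add)
  also have "\<dots> \<le> (\<Sum>p\<in>words k. \<Sum>q\<in>words m. \<Sum>t\<in>words (k + m). ?A p * ?X q t)"
    by (intro sum_mono) (simp add: entry cmod_sum_mult_power2_le)
  also have "\<dots> = (\<Sum>p\<in>words k. ?A p) * (\<Sum>q\<in>words m. \<Sum>t\<in>words (k + m). ?X q t)"
    by (simp only: sum_distrib_left[symmetric] sum_distrib_right[symmetric])
  also have "(\<Sum>q\<in>words m. \<Sum>t\<in>words (k + m). ?X q t)
      = (\<Sum>s\<in>words (k + m). \<Sum>t\<in>words (k + m). (cmod (x s t))\<^sup>2)"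
  proof -
    have "(\<Sum>q\<in>words m. \<Sum>t\<in>words (k + m). ?X q t)
        = (\<Sum>q\<in>words m. \<Sum>p'\<in>words k. \<Sum>t\<in>words (k + m). (cmod (x (p' @ q) t))\<^sup>2)"
      by (intro sum.cong refl sum.swap)
    also have "\<dots> = (\<Sum>p'\<in>words k. \<Sum>q\<in>words m. \<Sum>t\<in>words (k + m). (cmod (x (p' @ q) t))\<^sup>2)"
      by (rule sum.swap)
    finally show ?thesis
      by (simp add: sum_words_add[of "\<lambda>s. \<Sum>t\<in>words (k + m). (cmod (x s t))\<^sup>2"])
  qed
  finally show ?thesis .
qed

lemma bounded_linear_uhf_times: "bounded_linear (\<lambda>x. a * x :: ('n :: finite) uhf)"
proof -
  obtain k p where a: "a = of_wmat k p"
    using uhf_exhaust by blast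
  define C where "C = (\<Sum>s\<in>words k. \<Sum>t\<in>words k. (cmod (p s t))\<^sup>2)"
  show ?thesis
  proof (rule bounded_linear_intro)
    fix x y :: "'n uhf" and r :: real
    obtain l u v w where *: "a = of_wmat l u" "x = of_wmat l v" "y = of_wmat l w"
      using uhf_exhaust3[of a x y] by blast
    show "a * (x + y) = a * x + a * y"
      by (simp add: * plus_of_wmat times_of_wmat wmult_def distrib_left sum.distrib)
    show "a * (r *\<^sub>R x) = r *\<^sub>R (a * x)"
      by (simp add: * scaleR_uhf_def scaleC_of_wmat times_of_wmat wmult_def sum_distrib_left
          mult.left_commute)
  next
    fix x :: "'n uhf"
    obtain l v where l: "x = of_wmat l v"
      using uhf_exhaust by blast
    obtain b where x: "x = of_wmat (k + l) b"
      using of_wmat_mono[of l "k + l" v] l by auto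
    have ax: "a * x = of_wmat (k + l) (wmult (k + l) (wtensor k p wid) b)"
      using of_wmat_tensor[of k l p] by (simp add: a x flip: times_of_wmat)
    have "(a * x) \<bullet> (a * x) \<le> C * (x \<bullet> x)"
      unfolding ax unfolding x inner_of_wmat_self C_def
      using divide_right_mono[OF wmult_tensor_bound[of k l p b], of "real (CARD('n) ^ (k + l))"]
      by simp
    then have "(norm (a * x))\<^sup>2 \<le> C * (norm x)\<^sup>2"
      by (simp add: power2_norm_eq_inner)
    also have "\<dots> = (norm x * sqrt C)\<^sup>2"
      by (simp add: power_mult_distrib C_def sum_nonneg)
    finally show "norm (a * x) \<le> norm x * sqrt C"
      by (rule power2_le_imp_le) (simp add: C_def sum_nonneg)
  qed
qed

lemma inner_uhf_times: "(a * x) \<bullet> y = x \<bullet> (uadj a * (y :: ('n :: finite) uhf))"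
proof -
  obtain k p q w where *: "a = of_wmat k p" "x = of_wmat k q" "y = of_wmat k w"
    using uhf_exhaust3[of a x y] by blast
  have "(\<Sum>s\<in>words k. \<Sum>t\<in>words k. cnj (wmult k p q s t) * w s t)
      = (\<Sum>s\<in>words k. \<Sum>t\<in>words k. \<Sum>r\<in>words k. cnj (q r t) * (cnj (p s r) * w s t))"
    by (simp add: wmult_def sum_distrib_left sum_distrib_right mult_ac)
  also have "\<dots> = (\<Sum>s\<in>words k. \<Sum>r\<in>words k. \<Sum>t\<in>words k. cnj (q r t) * (cnj (p s r) * w s t))"
    by (intro sum.cong refl sum.swap)
  also have "\<dots> = (\<Sum>r\<in>words k. \<Sum>s\<in>words k. \<Sum>t\<in>words k. cnj (q r t) * (cnj (p s r) * w s t))"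
    by (rule sum.swap)
  also have "\<dots> = (\<Sum>r\<in>words k. \<Sum>t\<in>words k. \<Sum>s\<in>words k. cnj (q r t) * (cnj (p s r) * w s t))"
    by (intro sum.cong refl sum.swap)
  also have "\<dots> = (\<Sum>r\<in>words k. \<Sum>t\<in>words k. cnj (q r t) * wmult k (wadj p) w r t)"
    by (simp add: wmult_def wadj_def sum_distrib_left)
  finally have "cinner (a * x) y = cinner x (uadj a * y)"
    by (simp add: * times_of_wmat uadj_of_wmat cinner_of_wmat)
  then show ?thesis
    by (simp add: inner_uhf_def)
qed

lemma gns_rep_to_completion:
  "blinfun_apply (gns_rep a) (to_completion x) = to_completion (a * (x :: ('n :: finite) uhf))"
proof -
  define L where "L = Blinfun (\<lambda>y. uadj a * y)"
  have L: "blinfun_apply L y = uadj a * y" for y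
    by (simp add: L_def bounded_linear_Blinfun_apply bounded_linear_uhf_times)
  have J: "blinfun_inner_right x o\<^sub>L L = blinfun_inner_right (a * x)" for x
    by (rule blinfun_eqI) (simp add: L inner_uhf_times)
  have carrier: "f o\<^sub>L L \<in> completion_carrier" if f: "f \<in> completion_carrier" for f
  proof -
    obtain x where x: "(\<lambda>n. blinfun_inner_right (x n)) \<longlonglongrightarrow> f"
      using completion_carrier_limit[OF f] .
    have "(\<lambda>n. blinfun_inner_right (x n) o\<^sub>L L) \<longlonglongrightarrow> (f o\<^sub>L L)"
      by (intro tendsto_intros x)
    then show ?thesis
      unfolding J by (rule completion_carrierI)
  qed
  define T where "T h = Abs_completion (Rep_completion h o\<^sub>L L)" for h
  have Rep_T: "Rep_completion (T h) = Rep_completion h o\<^sub>L L" for h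
    by (simp add: T_def Abs_completion_inverse carrier Rep_completion)
  have "bounded_linear T"
  proof (rule bounded_linear_intro)
    show "T (g + h) = T g + T h" for g h
      by (simp add: Rep_completion_inject[symmetric] Rep_T plus_completion.rep_eq
          blinfun_eqI blinfun.add_left)
    show "T (r *\<^sub>R h) = r *\<^sub>R T h" for r h
      by (simp add: Rep_completion_inject[symmetric] Rep_T scaleR_completion.rep_eq
          blinfun_eqI blinfun.scaleR_left)
    show "norm (T h) \<le> norm h * norm L" for h
      using norm_blinfun_compose[of "Rep_completion h" L]
      by (simp add: norm_Rep_completion[symmetric] Rep_T)
  qed
  then have "blinfun_apply (Blinfun T) (to_completion x) = to_completion (a * x)" for x
    by (simp add: bounded_linear_Blinfun_apply Rep_completion_inject[symmetric] Rep_T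
        to_completion.rep_eq J)
  moreover have "S = S'" if "\<forall>x. blinfun_apply S (to_completion x) = to_completion (a * x)"
    and "\<forall>x. blinfun_apply S' (to_completion x) = to_completion (a * x)" for S S'
  proof (rule blinfun_eqI)
    fix h :: "'n gns"
    have "closed {h. blinfun_apply S h = blinfun_apply S' h}"
      by (intro closed_Collect_eq continuous_intros)
    then have "closure (range to_completion) \<subseteq> {h. blinfun_apply S h = blinfun_apply S' h}"
      using that by (intro closure_minimal) auto
    then show "blinfun_apply S h = blinfun_apply S' h"
      by (auto simp: dense_range_to_completion)
  qed
  ultimately have "\<exists>!T. \<forall>x. blinfun_apply T (to_completion x) = to_completion (a * x)"
    by blast
  from theI'[OF this] show ?thesis
    unfolding gns_rep_def by blast
qed


section \<open>Operator algebras\<close>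

text \<open>
  \<open>\<B>(H)\<close>: the complex-linear elements of \<open>'h \<Rightarrow>\<^sub>L 'h\<close>, which are a priori only real-linear.
\<close>

definition bounded_ops :: "('h :: chilbert_space \<Rightarrow>\<^sub>L 'h) set" where
  "bounded_ops = {T. \<forall>c x. blinfun_apply T (c *\<^sub>C x) = c *\<^sub>C blinfun_apply T x}"

text \<open>Existence and uniqueness of the adjoint: Riesz representation.\<close>

definition op_adj :: "('h :: chilbert_space \<Rightarrow>\<^sub>L 'h) \<Rightarrow> 'h \<Rightarrow>\<^sub>L 'h" where
  "op_adj T = (THE S. \<forall>x y. cinner (blinfun_apply S x) y = cinner x (blinfun_apply T y))"

text \<open>The coarsest topology on \<open>\<B>(H)\<close> making every \<open>T \<mapsto> \<langle>x, T y\<rangle>\<close> continuous.\<close>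

definition weak_operator_topology :: "('h :: chilbert_space \<Rightarrow>\<^sub>L 'h) topology" where
  "weak_operator_topology =
     pullback_topology bounded_ops (\<lambda>T (x, y). cinner x (blinfun_apply T y)) euclidean"

text \<open>
  A weakly closed unital \<open>*\<close>-subalgebra of \<open>\<B>(H)\<close>. Containing the scalars \<open>blinfun_scaleC c\<close> and
  being closed under composition yields both the unit and closure under complex multiples.
\<close>

definition von_neumann_algebra :: "('h :: chilbert_space \<Rightarrow>\<^sub>L 'h) set \<Rightarrow> bool" where
  "von_neumann_algebra M \<longleftrightarrow>
     closedin weak_operator_topology M \<and>
     (\<forall>c. blinfun_scaleC c \<in> M) \<and>
     (\<forall>S\<in>M. \<forall>T\<in>M. S + T \<in> M \<and> S o\<^sub>L T \<in> M) \<and>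
     (\<forall>T\<in>M. op_adj T \<in> M)"

definition vN_generated :: "('h :: chilbert_space \<Rightarrow>\<^sub>L 'h) set \<Rightarrow> ('h \<Rightarrow>\<^sub>L 'h) set" where
  "vN_generated S = \<Inter> {M. von_neumann_algebra M \<and> S \<subseteq> M}"

definition unitary_op :: "('h :: chilbert_space \<Rightarrow>\<^sub>L 'h) \<Rightarrow> bool" where
  "unitary_op W \<longleftrightarrow>
     W \<in> bounded_ops \<and> op_adj W o\<^sub>L W = id_blinfun \<and> W o\<^sub>L op_adj W = id_blinfun"

definition unitary_normalizer ::
    "('h :: chilbert_space \<Rightarrow>\<^sub>L 'h) set \<Rightarrow> ('h \<Rightarrow>\<^sub>L 'h) set \<Rightarrow> ('h \<Rightarrow>\<^sub>L 'h) set" where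
  "unitary_normalizer N M = {W \<in> M. unitary_op W \<and> (\<lambda>T. W o\<^sub>L T o\<^sub>L op_adj W) ` N = N}"

definition regular_inclusion ::
    "('h :: chilbert_space \<Rightarrow>\<^sub>L 'h) set \<Rightarrow> ('h \<Rightarrow>\<^sub>L 'h) set \<Rightarrow> bool" where
  "regular_inclusion N M \<longleftrightarrow> N \<subseteq> M \<and> vN_generated (unitary_normalizer N M) = M"

definition hyperfinite_factor :: "(('n :: finite) gns \<Rightarrow>\<^sub>L 'n gns) set" where
  "hyperfinite_factor = weak_operator_topology closure_of (\<Union>k. gns_rep ` range (of_wmat k))"


section \<open>Spin model subfactors\<close>

definition hadamard_unitary :: "complex ^ 'n ^ 'n \<Rightarrow> bool" where
  "hadamard_unitary u \<longleftrightarrow>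
     u ** (\<chi> i j. cnj (u $ j $ i)) = mat 1 \<and>
     (\<chi> i j. cnj (u $ j $ i)) ** u = mat 1 \<and>
     (\<forall>i j. cmod (u $ i $ j) = 1 / sqrt (real CARD('n)))"

definition of_matrix :: "complex ^ 'n ^ 'n \<Rightarrow> 'n wmat" where
  "of_matrix u = (\<lambda>s t. u $ hd s $ hd t)"

definition matrix_unit :: "'n \<Rightarrow> 'n \<Rightarrow> 'n wmat" where
  "matrix_unit i j = (\<lambda>s t. if s = [i] \<and> t = [j] then 1 else 0)"

definition spin_D :: "complex ^ 'n ^ 'n \<Rightarrow> ('n :: finite) wmat" where
  "spin_D u = (\<lambda>s t. complex_of_real (sqrt (real CARD('n))) *
     (\<Sum>i\<in>UNIV. \<Sum>j\<in>UNIV. cnj (u $ i $ j) * wtensor 1 (matrix_unit j j) (matrix_unit i i) s t))"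

definition spin_u1 :: "complex ^ 'n ^ 'n \<Rightarrow> ('n :: finite) wmat" where
  "spin_u1 u = wmult 2 (wtensor 1 (of_matrix u) wid) (spin_D u)"

text \<open>\<open>spin_unitary u k\<close> is \<open>u\<^bsub>2k-1\<^esub> \<in> M\<^sub>n\<^bsup>\<otimes>(k+1)\<^esup>\<close>.\<close>

definition spin_unitary :: "complex ^ 'n ^ 'n \<Rightarrow> nat \<Rightarrow> ('n :: finite) wmat" where
  "spin_unitary u k =
     foldr (\<lambda>i. wmult (k + 1) (wtensor i wid (wtensor 2 (spin_u1 u) wid))) [0..<k] wid"

text \<open>The algebra \<open>u\<^bsub>2k-1\<^esub> (M\<^sub>n\<^bsup>\<otimes>k\<^esup> \<otimes> 1) u\<^bsub>2k-1\<^esub>\<^sup>*\<close>.\<close>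

definition spin_algebra :: "complex ^ 'n ^ 'n \<Rightarrow> nat \<Rightarrow> ('n :: finite) uhf set" where
  "spin_algebra u k =
     {of_wmat (k + 1) (wmult (k + 1) (wmult (k + 1) (spin_unitary u k) (wtensor k x wid))
                                     (wadj (spin_unitary u k))) | x. True}"

definition spin_subfactor :: "complex ^ 'n ^ 'n \<Rightarrow> (('n :: finite) gns \<Rightarrow>\<^sub>L 'n gns) set" where
  "spin_subfactor u = weak_operator_topology closure_of (\<Union>k\<in>{1..}. gns_rep ` spin_algebra u k)"

end

theory Submission
  imports Defs
begin

text \<open>
  Let \<open>F\<close> be the Fourier matrix of the cyclic group with \<open>n\<close> elements and let \<open>W\<close> be a diagonal
  unitary with diagonal \<open>w\<close>. The subfactors are those of the Hadamard unitaries \<open>u = W F\<close>.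

  For any \<open>u\<close> the entry of \<open>u\<^bsub>2k-1\<^esub>\<close> at words \<open>s\<close>, \<open>t\<close> of length \<open>k + 1\<close> vanishes unless the last
  letters agree, and is then a product of weights of \<open>s\<^sub>p\<close>, \<open>s\<^bsub>p+1\<^esub>\<close> and \<open>t\<^sub>p\<close> (\<open>spin_unitary_entry\<close>).
  For \<open>u = W F\<close> the contribution of \<open>w\<close> telescopes, and what is left is a character of the word of
  consecutive differences of \<open>s\<close>. As the character matrix is invertible, conjugation by \<open>u\<^bsub>2k-1\<^esub>\<close>
  turns the matrices on \<open>k\<close> letters into exactly those of the form \<open>w(s\<^sub>1) y(ds, dt) w(t\<^sub>1)\<^sup>*\<close>, where
  \<open>ds\<close>, \<open>dt\<close> are the difference words (\<open>spin_algebra_twisted_fourier\<close>). Words with the same differences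
  are rotations of each other, so the union over \<open>k\<close> is the fixed-point algebra of an automorphism
  of order \<open>n\<close>: the simultaneous rotation of all letters, conjugated by \<open>W\<close> in the first tensor
  factor (\<open>spin_subfactor_twisted_fourier\<close>).

  Regularity: the Weyl unitaries, that is, products of a translation of words and a character,
  are eigenvectors of this automorphism, hence normalise its fixed points, and by Fourier
  inversion they span every matrix algebra of the tower (\<open>regular_twisted_fourier\<close>).
  Conversely, everything generated inside \<open>R\<close> stays inside because \<open>R\<close> is itself a von Neumann
  algebra, which rests on the separate weak continuity of the operations and the existence of
  adjoints.

  Distinctness: pairing with a matrix unit of the first tensor factor is weakly continuous, so
  the invariance under rotation survives in the weak closure (\<open>entry_functional_rot\<close>). The projection
  onto a vector \<open>w'\<close> in the first factor belongs to the subfactor of \<open>w'\<close>; if it also belongs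
  to that of \<open>w\<close>, the quotient \<open>h = w' / w\<close> has a constant ratio between cyclically consecutive
  values (\<open>twisted_fourier_same_subfactor\<close>). Letting \<open>w\<close> be \<open>1\<close> except for one value \<open>e\<^bsup>i\<theta>\<^esup>\<close> with
  \<open>0 < \<theta> < 1\<close> therefore gives a different subfactor for every \<open>\<theta>\<close> (\<open>phase_separates\<close>).
\<close>

section \<open>Adjoints of bounded operators\<close>

text \<open>
  Completeness enters only here: a minimising sequence of \<open>\<parallel>x\<parallel>\<^sup>2 - 2 f x\<close> is Cauchy by the
  parallelogram law, and the vanishing of the first variation at its limit \<open>z\<close> says that
  \<open>f\<close> is the inner product with \<open>z\<close>.
\<close>

lemma riesz_representation:
  fixes f :: "'a :: {real_inner, complete_space} \<Rightarrow> real"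
  assumes "bounded_linear f"
  shows "\<exists>z. \<forall>y. z \<bullet> y = f y"
proof -
  interpret f: bounded_linear f by fact
  define g where "g x = x \<bullet> x - 2 * f x" for x
  obtain K where K: "\<And>x. norm (f x) \<le> norm x * K"
    using f.bounded by blast
  have lower: "g x \<ge> - (K * K)" for x
  proof -
    have "f x \<le> norm x * K" using K[of x] by simp
    moreover have "0 \<le> (norm x - K) * (norm x - K)" by simp
    ultimately show ?thesis
      by (simp add: g_def power2_norm_eq_inner[symmetric] power2_eq_square algebra_simps)
  qed
  then have bdd: "bdd_below (range g)" by (auto simp: bdd_below_def)
  define m where "m = Inf (range g)"
  have m: "m \<le> g x" for x
    unfolding m_def by (rule cInf_lower) (auto intro: bdd)
  have "\<exists>x. g x < m + inverse (real (Suc n))" for n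
  proof -
    have "Inf (range g) < m + inverse (real (Suc n))" by (simp add: m_def)
    then show ?thesis by (auto simp: cInf_less_iff[OF _ bdd])
  qed
  then obtain x where x: "\<And>n. g (x n) < m + inverse (real (Suc n))" by metis
  \<comment> \<open>The parallelogram law, applied at the midpoint of \<open>a\<close> and \<open>b\<close>.\<close>
  have para: "(norm (a - b))\<^sup>2 \<le> 2 * (g a - m) + 2 * (g b - m)" for a b
  proof -
    have "g ((1/2) *\<^sub>R (a + b)) * 4 = (a + b) \<bullet> (a + b) - 4 * (f a + f b)"
      by (simp add: g_def f.add f.scaleR algebra_simps)
    moreover have "m \<le> g ((1/2) *\<^sub>R (a + b))" by (rule m)
    ultimately show ?thesis
      by (simp add: g_def power2_norm_eq_inner algebra_simps inner_commute)
  qed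
  have "Cauchy x"
  proof (rule metric_CauchyI)
    fix e :: real assume e: "e > 0"
    then have "e\<^sup>2 / 4 > 0" by simp
    then obtain M where M: "inverse (real (Suc M)) < e\<^sup>2 / 4"
      using reals_Archimedean by blast
    have half: "2 * a + 2 * b < c" if "a < c / 4" "b < c / 4" for a b c :: real
      using that by (simp add: field_simps)
    have small: "g (x k) - m < e\<^sup>2 / 4" if "k \<ge> M" for k
    proof -
      have "inverse (real (Suc k)) \<le> inverse (real (Suc M))"
        using that by (simp add: field_simps)
      with x[of k] M show ?thesis by linarith
    qed
    have "dist (x i) (x j) < e" if "i \<ge> M" "j \<ge> M" for i j
    proof -
      have "(dist (x i) (x j))\<^sup>2 < e\<^sup>2"
        unfolding dist_norm
        by (rule order_le_less_trans[OF para half[OF small[OF that(1)] small[OF that(2)]]])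
      then show ?thesis using e by (simp add: power_less_imp_less_base)
    qed
    then show "\<exists>M. \<forall>i\<ge>M. \<forall>j\<ge>M. dist (x i) (x j) < e" by blast
  qed
  then obtain z where z: "x \<longlonglongrightarrow> z" using Cauchy_convergent convergent_def by blast
  have "(\<lambda>n. g (x n)) \<longlonglongrightarrow> g z"
    unfolding g_def by (intro tendsto_intros z f.tendsto)
  moreover have "(\<lambda>n. m + inverse (real (Suc n))) \<longlonglongrightarrow> m + 0"
    by (intro tendsto_intros LIMSEQ_inverse_real_of_nat)
  ultimately have gz: "g z \<le> m"
    using LIMSEQ_le[of "\<lambda>n. g (x n)" "g z" "\<lambda>n. m + inverse (real (Suc n))"] x
    by (force intro: less_imp_le)
  have "z \<bullet> y = f y" for y
  proof -
    define d where "d = z \<bullet> y - f y"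
    \<comment> \<open>\<open>g\<close> is quadratic along the line \<open>z + t y\<close>, with its minimum at \<open>t = 0\<close>.\<close>
    have var: "0 \<le> t * t * (y \<bullet> y) + 2 * t * d" for t
    proof -
      have "g (z + t *\<^sub>R y) - g z = t * t * (y \<bullet> y) + 2 * t * d"
        by (simp add: g_def d_def f.add f.scaleR inner_commute algebra_simps)
      then show ?thesis using m[of "z + t *\<^sub>R y"] gz by linarith
    qed
    show ?thesis
    proof (cases "y \<bullet> y = 0")
      case True
      then show ?thesis by (simp add: f.zero)
    next
      case False
      then have yy: "y \<bullet> y > 0" by simp
      \<comment> \<open>The value of \<open>t\<close> at which the quadratic polynomial is smallest.\<close>
      have "0 \<le> - (d * d) / (y \<bullet> y)"
        using var[of "- d / (y \<bullet> y)"] yy by (simp add: field_simps)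
      then have "d = 0"
        using yy by (simp add: field_simps) (smt (verit) mult_eq_0_iff zero_le_square)
      then show ?thesis by (simp add: d_def)
    qed
  qed
  then show ?thesis by blast
qed

lemma bounded_opsD: "T \<in> bounded_ops \<Longrightarrow> blinfun_apply T (c *\<^sub>C x) = c *\<^sub>C blinfun_apply T x"
  by (simp add: bounded_ops_def)

lemma cinner_eqI:
  assumes "\<And>y. cinner x y = cinner (x' :: 'a :: complex_inner) y"
  shows "x = x'"
proof -
  have "(x - x') \<bullet> y = 0" for y
    using arg_cong[OF assms, of Re y] by (simp add: inner_diff_left flip: inner_eq_Re_cinner)
  from this[of "x - x'"] show ?thesis by simp
qed

lemma op_adj_eqI:
  fixes S T :: "'h :: chilbert_space \<Rightarrow>\<^sub>L 'h"
  assumes "\<And>x y. cinner (blinfun_apply S x) y = cinner x (blinfun_apply T y)"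
  shows "op_adj T = S"
  unfolding op_adj_def
proof (rule the_equality)
  fix S' assume S': "\<forall>x y. cinner (blinfun_apply S' x) y = cinner x (blinfun_apply T y)"
  show "S' = S"
    by (rule blinfun_eqI, rule cinner_eqI) (simp add: S' assms)
qed (simp add: assms)

text \<open>
  The Riesz representation theorem over the reals suffices: the resulting real-linear operator is
  adjoint also for the complex inner product, because \<open>T\<close> commutes with multiplication by \<open>\<i>\<close>.
\<close>

lemma cinner_op_adj:
  fixes T :: "'h :: chilbert_space \<Rightarrow>\<^sub>L 'h"
  assumes T: "T \<in> bounded_ops"
  shows "cinner (blinfun_apply (op_adj T) x) y = cinner x (blinfun_apply T y)"
proof -
  have "\<exists>z. \<forall>y. z \<bullet> y = x \<bullet> blinfun_apply T y" for x
    by (rule riesz_representation) (intro bounded_linear_intros)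
  then obtain S where S: "\<And>x y. S x \<bullet> y = x \<bullet> blinfun_apply T y" by metis
  have eqI: "a = b" if "\<And>y. a \<bullet> y = b \<bullet> y" for a b :: 'h
    using that[of "a - b"] by (metis inner_diff_left inner_eq_zero_iff right_minus_eq)
  have "bounded_linear S"
  proof (rule bounded_linear_intro)
    show "S (x + y) = S x + S y" for x y
      by (rule eqI) (simp add: S inner_add_left)
    show "S (r *\<^sub>R x) = r *\<^sub>R S x" for r x
      by (rule eqI) (simp add: S)
    show "norm (S x) \<le> norm x * norm T" for x
    proof (cases "S x = 0")
      case False
      have "norm (S x) * norm (S x) = x \<bullet> blinfun_apply T (S x)"
        using S[of x "S x"] by (simp add: power2_norm_eq_inner[symmetric] power2_eq_square)
      also have "\<dots> \<le> norm x * norm (blinfun_apply T (S x))"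
        by (rule norm_cauchy_schwarz)
      also have "\<dots> \<le> norm x * (norm T * norm (S x))"
        by (intro mult_left_mono norm_blinfun) simp
      finally have "norm (S x) * norm (S x) \<le> (norm x * norm T) * norm (S x)"
        by (simp add: mult.assoc)
      then show ?thesis using False by simp
    qed simp
  qed
  then have app: "blinfun_apply (Blinfun S) x = S x" for x
    by (simp add: bounded_linear_Blinfun_apply)
  have "cinner (blinfun_apply (Blinfun S) x) y = cinner x (blinfun_apply T y)" for x y
    unfolding app cinner_eq_inner
    by (simp add: S inner_scaleC_left flip: bounded_opsD[OF T])
  moreover from this have "op_adj T = Blinfun S"
    by (intro op_adj_eqI)
  ultimately show ?thesis by simp
qed

lemma op_adj_in_bounded_ops:
  assumes "T \<in> bounded_ops"
  shows "op_adj T \<in> bounded_ops"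
  unfolding bounded_ops_def
proof (intro CollectI allI)
  fix c x
  show "blinfun_apply (op_adj T) (c *\<^sub>C x) = c *\<^sub>C blinfun_apply (op_adj T) x"
    by (rule cinner_eqI) (simp add: cinner_op_adj[OF assms] cinner_scaleC_left)
qed

lemma cinner_op_adj_right:
  assumes "T \<in> bounded_ops"
  shows "cinner x (blinfun_apply (op_adj T) y) = cinner (blinfun_apply T x) y"
  by (metis assms cinner_commute cinner_op_adj)


section \<open>Weak closures of operator algebras\<close>

abbreviation wot :: "('h :: chilbert_space \<Rightarrow>\<^sub>L 'h) topology" where
  "wot \<equiv> weak_operator_topology"

lemma topspace_wot: "topspace wot = bounded_ops"
  by (simp add: weak_operator_topology_def topspace_pullback_topology)

lemma continuous_map_matrix_coefficient:
  "continuous_map wot euclidean (\<lambda>T. cinner x (blinfun_apply T y))"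
proof -
  have "continuous_map (euclidean :: ('a \<times> 'a \<Rightarrow> complex) topology) euclidean (\<lambda>f. f (x, y))"
    by (simp add: continuous_on_product_then_coordinatewise[OF continuous_on_id])
  from continuous_map_pullback[OF this, of bounded_ops "\<lambda>T (x, y). cinner x (blinfun_apply T y)"]
  show ?thesis by (simp add: weak_operator_topology_def comp_def)
qed

text \<open>
  The weak operator topology is the initial topology of the matrix coefficients.
\<close>

lemma continuous_map_into_wot:
  assumes "\<And>T. T \<in> topspace X \<Longrightarrow> F T \<in> bounded_ops"
    and "\<And>x y. continuous_map X euclidean (\<lambda>T. cinner x (blinfun_apply (F T) y))"
  shows "continuous_map X wot F"
  unfolding weak_operator_topology_def
proof (rule continuous_map_pullback')
  show "topspace X \<subseteq> F -` bounded_ops" using assms(1) by blast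
  show "continuous_map X euclidean ((\<lambda>T (x, y). cinner x (blinfun_apply T y)) \<circ> F)"
    unfolding euclidean_product_topology[symmetric] continuous_map_componentwise_UNIV
    using assms(2) by (auto simp: comp_def)
qed

lemma bounded_ops_closed:
  assumes "S \<in> bounded_ops" "T \<in> bounded_ops"
  shows "S + T \<in> bounded_ops" "S o\<^sub>L T \<in> bounded_ops"
  using assms by (auto simp: bounded_ops_def blinfun.add_left scaleC_add_right)

lemma continuous_map_wot_add:
  assumes "S \<in> bounded_ops"
  shows "continuous_map wot wot (\<lambda>T. S + T)"
proof (rule continuous_map_into_wot)
  show "continuous_map wot euclidean (\<lambda>T. cinner x (blinfun_apply (S + T) y))" for x y
    unfolding blinfun.add_left cinner_add_right
    by (intro continuous_map_add continuous_map_matrix_coefficient) simp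
qed (simp add: topspace_wot bounded_ops_closed assms)

lemma continuous_map_wot_compose_left:
  assumes "S \<in> bounded_ops"
  shows "continuous_map wot wot (\<lambda>T. S o\<^sub>L T)"
proof (rule continuous_map_into_wot)
  show "continuous_map wot euclidean (\<lambda>T. cinner x (blinfun_apply (S o\<^sub>L T) y))" for x y
    using continuous_map_matrix_coefficient[of "blinfun_apply (op_adj S) x" y]
    by (simp add: cinner_op_adj[OF assms])
qed (simp add: topspace_wot bounded_ops_closed assms)

lemma continuous_map_wot_compose_right:
  assumes "S \<in> bounded_ops"
  shows "continuous_map wot wot (\<lambda>T. T o\<^sub>L S)"
proof (rule continuous_map_into_wot)
  show "continuous_map wot euclidean (\<lambda>T. cinner x (blinfun_apply (T o\<^sub>L S) y))" for x y
    using continuous_map_matrix_coefficient[of x "blinfun_apply S y"] by simp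
qed (simp add: topspace_wot bounded_ops_closed assms)

lemma continuous_map_wot_op_adj: "continuous_map wot wot op_adj"
proof (rule continuous_map_into_wot)
  fix x y :: 'a
  have "continuous_map wot euclidean (\<lambda>T. cnj (cinner y (blinfun_apply T x)))"
    using continuous_map_compose[OF continuous_map_matrix_coefficient, of euclidean cnj y x]
    by (simp add: comp_def continuous_on_cnj)
  then show "continuous_map wot euclidean (\<lambda>T. cinner x (blinfun_apply (op_adj T) y))"
    by (rule continuous_map_eq)
       (metis cinner_commute cinner_op_adj_right topspace_wot)
qed (simp add: topspace_wot op_adj_in_bounded_ops)

lemma closure_of_mapsto:
  assumes "continuous_map X Y f" "f ` A \<subseteq> B"
  shows "f ` (X closure_of A) \<subseteq> Y closure_of B"
  using continuous_map_image_closure_subset[OF assms(1), of A] closure_of_mono[OF assms(2), of Y]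
  by blast

text \<open>
  Composition is only separately continuous, so products of two limits are reached in two
  steps, replacing one factor by its limit at a time.
\<close>

lemma closure_of_binary_mapsto:
  fixes f :: "('h :: chilbert_space \<Rightarrow>\<^sub>L 'h) \<Rightarrow> ('h \<Rightarrow>\<^sub>L 'h) \<Rightarrow> 'h \<Rightarrow>\<^sub>L 'h"
  assumes A: "A \<subseteq> bounded_ops"
    and left: "\<And>S. S \<in> bounded_ops \<Longrightarrow> continuous_map wot wot (f S)"
    and right: "\<And>T. T \<in> bounded_ops \<Longrightarrow> continuous_map wot wot (\<lambda>S. f S T)"
    and f: "\<And>S T. S \<in> A \<Longrightarrow> T \<in> A \<Longrightarrow> f S T \<in> A"
    and S: "S \<in> wot closure_of A" and T: "T \<in> wot closure_of A"
  shows "f S T \<in> wot closure_of A"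
proof -
  have 1: "f S' T \<in> wot closure_of A" if "S' \<in> A" for S'
    using closure_of_mapsto[OF left, of S' A A] f that A T by blast
  have "T \<in> bounded_ops"
    using T closure_of_subset_topspace[of wot A] by (auto simp: topspace_wot)
  then have "(\<lambda>S. f S T) ` (wot closure_of A) \<subseteq> wot closure_of (wot closure_of A)"
    using 1 by (intro closure_of_mapsto[OF right]) auto
  then show ?thesis using S by auto
qed

lemma von_neumann_algebra_closure:
  fixes A :: "('h :: chilbert_space \<Rightarrow>\<^sub>L 'h) set"
  assumes A: "A \<subseteq> bounded_ops" and scal: "\<And>c. blinfun_scaleC c \<in> A"
    and add: "\<And>S T. S \<in> A \<Longrightarrow> T \<in> A \<Longrightarrow> S + T \<in> A"
    and comp: "\<And>S T. S \<in> A \<Longrightarrow> T \<in> A \<Longrightarrow> S o\<^sub>L T \<in> A"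
    and adj: "\<And>T. T \<in> A \<Longrightarrow> op_adj T \<in> A"
  shows "von_neumann_algebra (wot closure_of A)"
  unfolding von_neumann_algebra_def
proof (intro conjI allI ballI)
  show "closedin wot (wot closure_of A)" by (rule closedin_closure_of)
  show "blinfun_scaleC c \<in> wot closure_of A" for c
    using closure_of_subset[of A wot] A scal by (auto simp: topspace_wot)
  have right: "continuous_map wot wot (\<lambda>S. S + T)" if "T \<in> bounded_ops" for T :: "'h \<Rightarrow>\<^sub>L 'h"
    using continuous_map_wot_add[OF that] by (simp add: add.commute)
  fix S assume S: "S \<in> wot closure_of A"
  show "op_adj S \<in> wot closure_of A"
    using closure_of_mapsto[OF continuous_map_wot_op_adj, of A A] adj S by blast
  fix T assume T: "T \<in> wot closure_of A"
  show "S + T \<in> wot closure_of A"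
    by (rule closure_of_binary_mapsto[OF A continuous_map_wot_add right add S T])
  show "S o\<^sub>L T \<in> wot closure_of A"
    by (rule closure_of_binary_mapsto[OF A continuous_map_wot_compose_left
          continuous_map_wot_compose_right comp S T])
qed

text \<open>Conjugation by a unitary is a homeomorphism, so normalising a dense subset suffices.\<close>

lemma unitary_normalizer_closure:
  assumes W: "unitary_op W" "W \<in> M"
    and "\<And>T. T \<in> A \<Longrightarrow> W o\<^sub>L T o\<^sub>L op_adj W \<in> A"
    and "\<And>T. T \<in> A \<Longrightarrow> op_adj W o\<^sub>L T o\<^sub>L W \<in> A"
  shows "W \<in> unitary_normalizer (wot closure_of A) M"
proof -
  have b: "W \<in> bounded_ops" "op_adj W \<in> bounded_ops"
    using W op_adj_in_bounded_ops by (auto simp: unitary_op_def)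
  have cont: "continuous_map wot wot (\<lambda>T. P o\<^sub>L T o\<^sub>L Q)"
    if "P \<in> bounded_ops" "Q \<in> bounded_ops" for P Q :: "'a \<Rightarrow>\<^sub>L 'a"
    using continuous_map_compose[OF continuous_map_wot_compose_left[OF that(1)]
        continuous_map_wot_compose_right[OF that(2)]] by (simp add: comp_def)
  have 1: "(\<lambda>T. W o\<^sub>L T o\<^sub>L op_adj W) ` (wot closure_of A) \<subseteq> wot closure_of A"
    using assms(3) by (intro closure_of_mapsto[OF cont] b) auto
  have 2: "(\<lambda>T. op_adj W o\<^sub>L T o\<^sub>L W) ` (wot closure_of A) \<subseteq> wot closure_of A"
    using assms(4) by (intro closure_of_mapsto[OF cont] b) auto
  \<comment> \<open>The inverse conjugation also preserves the closure, so the image is all of it.\<close>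
  have WW: "W o\<^sub>L op_adj W = id_blinfun" using W by (simp add: unitary_op_def)
  have "T = W o\<^sub>L (op_adj W o\<^sub>L T o\<^sub>L W) o\<^sub>L op_adj W" for T
  proof (rule blinfun_eqI)
    have *: "blinfun_apply W (blinfun_apply (op_adj W) x) = x" for x
      using arg_cong[OF WW, of "\<lambda>S. blinfun_apply S x"] by simp
    show "blinfun_apply T x = blinfun_apply (W o\<^sub>L (op_adj W o\<^sub>L T o\<^sub>L W) o\<^sub>L op_adj W) x" for x
      by (simp add: *)
  qed
  then have "wot closure_of A \<subseteq> (\<lambda>T. W o\<^sub>L T o\<^sub>L op_adj W) ` (wot closure_of A)"
    using 2 by blast
  with 1 W show ?thesis by (auto simp: unitary_normalizer_def)
qed


section \<open>The GNS representation as a star-homomorphism\<close>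

lemma to_completion_scaleC: "to_completion (c *\<^sub>C x) = c *\<^sub>C to_completion x"
  by transfer (simp add: blinfun_inner_right_scaleC)

lemma cinner_to_completion: "cinner (to_completion x) (to_completion y) = cinner x y"
  by (simp add: cinner_eq_inner inner_to_completion flip: to_completion_scaleC)

lemma to_completion_add: "to_completion (x + y) = to_completion x + to_completion y"
  by transfer (rule blinfun_eqI, simp add: inner_add_left blinfun.add_left)

text \<open>
  Vectors and operators of the GNS space are determined by their behaviour on the dense copy of
  the matrices; this reduces identities between operators to matrix identities.
\<close>

lemma to_completion_separating:
  assumes "\<And>y. z \<bullet> to_completion y = z' \<bullet> to_completion y"
  shows "z = z'"
proof -
  have "closed {h. z \<bullet> h = z' \<bullet> h}"
    by (intro closed_Collect_eq continuous_intros)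
  then have "closure (range to_completion) \<subseteq> {h. z \<bullet> h = z' \<bullet> h}"
    using assms by (intro closure_minimal) auto
  then have "z \<bullet> (z - z') = z' \<bullet> (z - z')"
    by (auto simp: dense_range_to_completion)
  then have "(z - z') \<bullet> (z - z') = 0" by (simp add: inner_diff_left)
  then show ?thesis by simp
qed

lemma blinfun_eqI_dense:
  assumes "\<And>x. blinfun_apply S (to_completion x) = blinfun_apply T (to_completion x)"
  shows "S = T"
proof (rule blinfun_eqI)
  fix h
  have "closed {h. blinfun_apply S h = blinfun_apply T h}"
    by (intro closed_Collect_eq continuous_intros)
  then have "closure (range to_completion) \<subseteq> {h. blinfun_apply S h = blinfun_apply T h}"
    using assms by (intro closure_minimal) auto
  then show "blinfun_apply S h = blinfun_apply T h"
    by (auto simp: dense_range_to_completion)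
qed

lemma wmult_assoc: "wmult k (wmult k a b) c = wmult k a (wmult k b c)"
proof (intro ext)
  fix s t
  have "(\<Sum>r\<in>words k. (\<Sum>q\<in>words k. a s q * b q r) * c r t)
      = (\<Sum>r\<in>words k. \<Sum>q\<in>words k. a s q * (b q r * c r t))"
    by (simp add: sum_distrib_right mult.assoc)
  also have "\<dots> = (\<Sum>q\<in>words k. \<Sum>r\<in>words k. a s q * (b q r * c r t))"
    by (rule sum.swap)
  finally show "wmult k (wmult k a b) c s t = wmult k a (wmult k b c) s t"
    by (simp add: wmult_def sum_distrib_left)
qed

lemma wmult_wid_left:
  fixes a :: "('n :: finite) wmat"
  assumes "s \<in> words k"
  shows "wmult k wid a s t = a s t"
proof -
  have "(\<Sum>r\<in>words k. wid s r * a r t) = (\<Sum>r\<in>words k. if r = s then a r t else 0)"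
    by (intro sum.cong) (auto simp: wid_def)
  then show ?thesis using assms by (simp add: wmult_def)
qed

lemma of_wmat_cong:
  "(\<And>s t. s \<in> words k \<Longrightarrow> t \<in> words k \<Longrightarrow> a s t = b s t) \<Longrightarrow> of_wmat k a = of_wmat k b"
  by transfer (rule wmat_kernel_cong)

lemma uhf_times_assoc: "(a * b) * c = a * (b * (c :: ('n :: finite) uhf))"
proof -
  obtain k p q r where "a = of_wmat k p" "b = of_wmat k q" "c = of_wmat k r"
    using uhf_exhaust3[of a b c] by blast
  then show ?thesis by (simp add: times_of_wmat wmult_assoc)
qed

lemma uhf_distrib_right: "(a + b) * c = a * c + b * (c :: ('n :: finite) uhf)"
proof -
  obtain k p q r where "a = of_wmat k p" "b = of_wmat k q" "c = of_wmat k r"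
    using uhf_exhaust3[of a b c] by blast
  then show ?thesis
    by (simp add: times_of_wmat plus_of_wmat wmult_def distrib_right sum.distrib)
qed

lemma uhf_scaleC_times: "(d *\<^sub>C a) * c = d *\<^sub>C (a * (c :: ('n :: finite) uhf))"
proof -
  obtain k p q r where "a = of_wmat k p" "c = of_wmat k r"
    using uhf_exhaust3[of a a c] by blast
  then show ?thesis
    by (simp add: times_of_wmat scaleC_of_wmat wmult_def sum_distrib_left mult.assoc)
qed

definition uone :: "('n :: finite) uhf" where
  "uone = of_wmat 0 wid"

lemma uone_of_wmat: "uone = of_wmat k wid"
  using of_wmat_tensor[of 0 k wid, symmetric] by (simp add: uone_def wtensor_def wid_def)

lemma uone_times [simp]: "uone * x = (x :: ('n :: finite) uhf)"
proof -
  obtain k p where x: "x = of_wmat k p" using uhf_exhaust by blast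
  show ?thesis
    unfolding x uone_of_wmat[of k] times_of_wmat
    by (rule of_wmat_cong) (rule wmult_wid_left)
qed

lemma uadj_uadj [simp]: "uadj (uadj x) = x"
  by transfer simp

lemma gns_rep_times: "gns_rep (a * b) = gns_rep a o\<^sub>L gns_rep b"
  by (rule blinfun_eqI_dense) (simp add: gns_rep_to_completion uhf_times_assoc)

lemma gns_rep_add: "gns_rep (a + b) = gns_rep a + gns_rep b"
  by (rule blinfun_eqI_dense)
     (simp add: gns_rep_to_completion uhf_distrib_right blinfun.add_left to_completion_add)

lemma gns_rep_scaleC: "gns_rep (c *\<^sub>C a) = blinfun_scaleC c o\<^sub>L gns_rep a"
  by (rule blinfun_eqI_dense)
     (simp add: gns_rep_to_completion uhf_scaleC_times blinfun_scaleC.rep_eq to_completion_scaleC)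

lemma gns_rep_uone: "gns_rep uone = id_blinfun"
  by (rule blinfun_eqI_dense) (simp add: gns_rep_to_completion)

lemma gns_rep_scalar: "gns_rep (c *\<^sub>C uone) = blinfun_scaleC c"
  by (rule blinfun_eqI_dense)
     (simp add: gns_rep_scaleC gns_rep_to_completion)

lemma uhf_times_scaleC: "a * (d *\<^sub>C c) = d *\<^sub>C (a * (c :: ('n :: finite) uhf))"
proof -
  obtain k p q r where "a = of_wmat k p" "c = of_wmat k r"
    using uhf_exhaust3[of a a c] by blast
  then show ?thesis
    by (simp add: times_of_wmat scaleC_of_wmat wmult_def sum_distrib_left mult.left_commute)
qed

lemma gns_rep_in_bounded_ops: "gns_rep a \<in> bounded_ops"
proof -
  have "gns_rep a o\<^sub>L blinfun_scaleC c = blinfun_scaleC c o\<^sub>L gns_rep a" for c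
    by (rule blinfun_eqI_dense)
       (simp add: blinfun_scaleC.rep_eq gns_rep_to_completion uhf_times_scaleC
         flip: to_completion_scaleC)
  from arg_cong[OF this, of blinfun_apply] show ?thesis
    by (auto simp: bounded_ops_def fun_eq_iff blinfun_scaleC.rep_eq)
qed

lemma op_adj_gns_rep: "op_adj (gns_rep a) = gns_rep (uadj a)"
proof (rule blinfun_eqI_dense, rule to_completion_separating)
  fix x y
  have "blinfun_apply (op_adj (gns_rep a)) (to_completion x) \<bullet> to_completion y
      = to_completion x \<bullet> blinfun_apply (gns_rep a) (to_completion y)"
    unfolding inner_eq_Re_cinner by (simp add: cinner_op_adj gns_rep_in_bounded_ops)
  also have "\<dots> = (uadj a * x) \<bullet> y"
    by (simp add: gns_rep_to_completion inner_to_completion inner_uhf_times)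
  finally show "blinfun_apply (op_adj (gns_rep a)) (to_completion x) \<bullet> to_completion y
      = blinfun_apply (gns_rep (uadj a)) (to_completion x) \<bullet> to_completion y"
    by (simp add: gns_rep_to_completion inner_to_completion)
qed

definition unitary_uhf :: "('n :: finite) uhf \<Rightarrow> bool" where
  "unitary_uhf v \<longleftrightarrow> uadj v * v = uone \<and> v * uadj v = uone"

lemma unitary_op_gns_rep: "unitary_uhf v \<Longrightarrow> unitary_op (gns_rep v)"
  by (simp add: unitary_op_def unitary_uhf_def op_adj_gns_rep gns_rep_in_bounded_ops gns_rep_uone
      flip: gns_rep_times)

lemma hyperfinite_factor_eq: "hyperfinite_factor = wot closure_of range gns_rep"
proof -
  have "(\<Union>k. gns_rep ` range (of_wmat k)) = gns_rep ` (\<Union>k. range (of_wmat k))" by blast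
  also have "(\<Union>k. range (of_wmat k)) = (UNIV :: 'n uhf set)" using uhf_exhaust by blast
  finally show ?thesis unfolding hyperfinite_factor_def by (rule arg_cong)
qed

lemma range_gns_rep_subset: "range gns_rep \<subseteq> wot closure_of range gns_rep"
  using gns_rep_in_bounded_ops by (intro closure_of_subset) (auto simp: topspace_wot)

text \<open>
  This is what bounds the algebra generated by normalising unitaries from above.
\<close>

lemma von_neumann_algebra_hyperfinite_factor: "von_neumann_algebra hyperfinite_factor"
  unfolding hyperfinite_factor_eq
proof (rule von_neumann_algebra_closure)
  show "range gns_rep \<subseteq> bounded_ops" using gns_rep_in_bounded_ops by blast
  show "blinfun_scaleC c \<in> range gns_rep" for c by (metis gns_rep_scalar rangeI)
  show "S + T \<in> range gns_rep" if "S \<in> range gns_rep" "T \<in> range gns_rep" for S T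
    using that by (auto simp flip: gns_rep_add)
  show "S o\<^sub>L T \<in> range gns_rep" if "S \<in> range gns_rep" "T \<in> range gns_rep" for S T
    using that by (auto simp flip: gns_rep_times)
  show "op_adj T \<in> range gns_rep" if "T \<in> range gns_rep" for T
    using that by (auto simp: op_adj_gns_rep)
qed

lemma von_neumann_algebra_gns_rep_sum:
  fixes v :: "'i \<Rightarrow> ('n :: finite) uhf"
  assumes M: "von_neumann_algebra M" and "finite I" and v: "\<And>i. i \<in> I \<Longrightarrow> gns_rep (v i) \<in> M"
  shows "gns_rep (\<Sum>i\<in>I. c i *\<^sub>C v i) \<in> M"
  using assms(2) v
proof (induction I)
  case empty
  have "gns_rep (0 :: 'n uhf) = blinfun_scaleC 0"
    using gns_rep_add[of "0 :: 'n uhf" 0]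
    by (intro blinfun_eqI) (simp add: blinfun_scaleC.rep_eq scaleC_of_real[of 0, simplified])
  then show ?case using M by (simp add: von_neumann_algebra_def)
next
  case (insert i I)
  then show ?case using M
    by (simp add: gns_rep_add gns_rep_scaleC von_neumann_algebra_def)
qed

text \<open>
  Regularity of the closure of an algebra \<open>A\<close> of matrices can be read off inside the tower:
  the matrix unitaries normalising \<open>A\<close> only have to span it.
\<close>

lemma regular_inclusion_closureI:
  fixes A V :: "('n :: finite) uhf set"
  assumes unit: "\<And>v. v \<in> V \<Longrightarrow> unitary_uhf v"
    and norm: "\<And>v x. v \<in> V \<Longrightarrow> x \<in> A \<Longrightarrow> v * x * uadj v \<in> A"
      "\<And>v x. v \<in> V \<Longrightarrow> x \<in> A \<Longrightarrow> uadj v * x * v \<in> A"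
    and span: "\<And>x. \<exists>I c v. finite I \<and> v ` I \<subseteq> V \<and> x = (\<Sum>i\<in>(I :: 'i set). c i *\<^sub>C v i)"
  shows "regular_inclusion (wot closure_of gns_rep ` A) hyperfinite_factor"
proof -
  let ?N = "wot closure_of gns_rep ` A"
  have V: "gns_rep v \<in> unitary_normalizer ?N hyperfinite_factor" if v: "v \<in> V" for v
  proof (rule unitary_normalizer_closure)
    show "unitary_op (gns_rep v)" using unit[OF v] by (rule unitary_op_gns_rep)
    show "gns_rep v \<in> hyperfinite_factor"
      unfolding hyperfinite_factor_eq using range_gns_rep_subset by blast
    show "gns_rep v o\<^sub>L T o\<^sub>L op_adj (gns_rep v) \<in> gns_rep ` A" if "T \<in> gns_rep ` A" for T
      using norm(1)[OF v] that by (auto simp: op_adj_gns_rep simp flip: gns_rep_times)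
    show "op_adj (gns_rep v) o\<^sub>L T o\<^sub>L gns_rep v \<in> gns_rep ` A" if "T \<in> gns_rep ` A" for T
      using norm(2)[OF v] that by (auto simp: op_adj_gns_rep simp flip: gns_rep_times)
  qed
  have "hyperfinite_factor \<subseteq> M"
    if M: "von_neumann_algebra M" "unitary_normalizer ?N hyperfinite_factor \<subseteq> M" for M
  proof -
    have "gns_rep x \<in> M" for x
    proof -
      obtain I c v where I: "finite I" "v ` I \<subseteq> V" "x = (\<Sum>i\<in>(I :: 'i set). c i *\<^sub>C v i)"
        using span[of x] by blast
      show ?thesis
        unfolding I(3) using I(2) V M by (intro von_neumann_algebra_gns_rep_sum I(1)) auto
    qed
    moreover have "closedin wot M" using M by (simp add: von_neumann_algebra_def)
    ultimately show ?thesis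
      unfolding hyperfinite_factor_eq by (intro closure_of_minimal) auto
  qed
  then have "hyperfinite_factor \<subseteq> vN_generated (unitary_normalizer ?N hyperfinite_factor)"
    unfolding vN_generated_def by blast
  moreover have "vN_generated (unitary_normalizer ?N hyperfinite_factor) \<subseteq> hyperfinite_factor"
    unfolding vN_generated_def
    using von_neumann_algebra_hyperfinite_factor by (auto simp: unitary_normalizer_def)
  moreover have "?N \<subseteq> hyperfinite_factor"
    unfolding hyperfinite_factor_eq by (rule closure_of_mono) blast
  ultimately show ?thesis by (simp add: regular_inclusion_def)
qed


section \<open>Cyclic letters and their characters\<close>

text \<open>The choice of a cyclic order on the \<open>n\<close> letters; \<open>letter\<close> is \<open>n\<close>-periodic.\<close>

definition pos :: "'n :: finite \<Rightarrow> nat" where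
  "pos = (SOME c. bij_betw c UNIV {..<CARD('n)})"

definition letter :: "nat \<Rightarrow> 'n :: finite" where
  "letter m = inv pos (m mod CARD('n))"

definition rot :: "nat \<Rightarrow> 'n \<Rightarrow> 'n :: finite" where
  "rot m i = letter (pos i + m)"

text \<open>
  Subtraction in the cyclic group of letters, as a rotation by the complementary number of steps.
\<close>

definition dif :: "'n \<Rightarrow> 'n \<Rightarrow> 'n :: finite" where
  "dif i j = rot (CARD('n) - pos j) i"

lemma bij_pos: "bij_betw pos (UNIV :: 'n :: finite set) {..<CARD('n)}"
proof -
  have "\<exists>c. bij_betw c (UNIV :: 'n set) {..<CARD('n)}"
    using ex_bij_betw_finite_nat[of "UNIV :: 'n set"] by (simp add: lessThan_atLeast0)
  then show ?thesis unfolding pos_def by (rule someI_ex)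
qed

lemma pos_less [simp]: "pos (i :: 'n :: finite) < CARD('n)"
  using bij_pos[where 'n='n] by (auto simp: bij_betw_def)

lemma pos_inject [simp]: "pos i = pos j \<longleftrightarrow> i = j"
  using bij_pos by (auto simp: bij_betw_def inj_on_def)

lemma pos_letter: "pos (letter m :: 'n :: finite) = m mod CARD('n)"
proof -
  have "m mod CARD('n) \<in> range (pos :: 'n \<Rightarrow> nat)"
    using bij_pos[where 'n='n] by (simp add: bij_betw_def)
  then show ?thesis by (simp add: letter_def f_inv_into_f)
qed

lemma pos_rot: "pos (rot m i :: 'n :: finite) = (pos i + m) mod CARD('n)"
  by (simp add: rot_def pos_letter)

lemma rot_rot: "rot m (rot l i) = rot (l + m) (i :: 'n :: finite)"
  by (simp add: pos_rot mod_add_left_eq add.assoc flip: pos_inject)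

lemma rot_full: "m mod CARD('n) = 0 \<Longrightarrow> rot m (i :: 'n :: finite) = i"
  by (metis add_0_right mod_add_right_eq mod_less pos_inject pos_less pos_rot)

lemma rot_inject [simp]: "rot m i = rot m j \<longleftrightarrow> i = (j :: 'n :: finite)"
proof
  have "(m + (CARD('n) * m - m)) mod CARD('n) = 0" by simp
  then have *: "rot (CARD('n) * m - m) (rot m i) = i" for i :: 'n
    unfolding rot_rot by (rule rot_full)
  show "rot m i = rot m j \<Longrightarrow> i = j" by (metis *)
qed simp

lemma bij_rot: "bij (rot m :: 'n :: finite \<Rightarrow> 'n)"
  by (simp add: bij_def finite_UNIV_inj_surj inj_def)

lemma rot_pos_dif: "rot (pos (rot m j)) (dif i j) = rot m (i :: 'n :: finite)"
proof -
  let ?n = "CARD('n)"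
  have "(pos i + (?n - pos j) + pos (rot m j)) mod ?n = (pos i + (?n - pos j) + (pos j + m)) mod ?n"
    by (metis mod_add_right_eq pos_rot)
  also have "pos i + (?n - pos j) + (pos j + m) = pos i + m + ?n"
    using pos_less[of j] by linarith
  finally show ?thesis
    by (simp add: dif_def pos_rot mod_add_left_eq mod_add_right_eq rot_rot add.assoc mod_add_self2[of "pos i + m", simplified add.assoc] flip: pos_inject)
qed

lemma rot_zero [simp]: "rot 0 i = (i :: 'n :: finite)"
  by (simp add: rot_full)

lemma dif_rot: "dif (rot m i) (rot m j) = dif i (j :: 'n :: finite)"
proof -
  have "rot (pos (rot m j)) (dif (rot m i) (rot m j)) = rot (pos (rot m j)) (dif i j)"
    using rot_pos_dif[of 0 "rot m j" "rot m i"] rot_pos_dif[of m j i] by simp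
  then show ?thesis by simp
qed

text \<open>
  The primitive \<open>n\<close>-th root of unity \<open>e\<^bsup>2\<pi>i/n\<^esup>\<close>, indexed by the type of letters.
\<close>

definition zeta :: "'n :: finite itself \<Rightarrow> complex" where
  "zeta _ = cis (2 * pi / real CARD('n))"

definition chi :: "'n \<Rightarrow> 'n :: finite \<Rightarrow> complex" where
  "chi i j = zeta TYPE('n) ^ (pos i * pos j)"

lemma norm_zeta [simp]: "cmod (zeta TYPE('n :: finite)) = 1"
  by (simp add: zeta_def)

lemma zeta_power_card: "zeta TYPE('n :: finite) ^ CARD('n) = 1"
  by (simp only: zeta_def Complex.DeMoivre) simp

lemma zeta_power_mod: "zeta TYPE('n :: finite) ^ (m mod CARD('n)) = zeta TYPE('n) ^ m"
proof -
  have "zeta TYPE('n) ^ m = zeta TYPE('n) ^ (CARD('n) * (m div CARD('n)) + m mod CARD('n))"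
    by simp
  also have "\<dots> = zeta TYPE('n) ^ (m mod CARD('n))"
    by (simp only: power_add power_mult zeta_power_card) simp
  finally show ?thesis by simp
qed

lemma zeta_power_inject:
  assumes "a < CARD('n :: finite)" "b < CARD('n)" "zeta TYPE('n) ^ a = zeta TYPE('n) ^ b"
  shows "a = b"
proof -
  have "inj_on (\<lambda>k. cis (2 * pi * real k / real CARD('n))) {..<CARD('n)}"
    using Complex.bij_betw_roots_unity[of "CARD('n)"] by (simp add: bij_betw_def)
  moreover have "zeta TYPE('n) ^ k = cis (2 * pi * real k / real CARD('n))" for k
    by (simp add: zeta_def Complex.DeMoivre mult.commute)
  ultimately show ?thesis using assms by (auto simp: inj_on_def)
qed

lemma cnj_mult_self_unit: "cmod z = 1 \<Longrightarrow> cnj z * z = 1" "cmod z = 1 \<Longrightarrow> z * cnj z = 1"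
  using complex_norm_square[of z] by (simp_all add: mult.commute)

lemma norm_chi [simp]: "cmod (chi i j) = 1"
  by (simp add: chi_def norm_power)

lemma chi_commute: "chi i j = chi j i"
  by (simp add: chi_def mult.commute)

lemma chi_rot: "chi (rot m i) j = zeta TYPE('n) ^ (m * pos j) * chi i (j :: 'n :: finite)"
proof -
  have "chi (rot m i) j = (zeta TYPE('n) ^ ((pos i + m) mod CARD('n))) ^ pos j"
    by (simp add: chi_def pos_rot power_mult)
  then show ?thesis
    by (simp add: zeta_power_mod chi_def power_add power_mult power_mult_distrib mult.commute)
qed

lemma chi_dif: "chi (dif i j) k = chi i k * cnj (chi j (k :: 'n :: finite))"
proof -
  have "zeta TYPE('n) ^ ((CARD('n) - pos j) * pos k) * chi j k = 1"
  proof -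
    have "(CARD('n) - pos j) * pos k + pos j * pos k = CARD('n) * pos k"
      using pos_less[of j] by (simp add: less_imp_le flip: add_mult_distrib)
    then show ?thesis
      by (simp add: chi_def flip: power_add) (simp add: power_mult zeta_power_card)
  qed
  then have "zeta TYPE('n) ^ ((CARD('n) - pos j) * pos k) = cnj (chi j k)"
    by (metis cnj_mult_self_unit(2) mult.assoc mult.commute mult.left_neutral norm_chi)
  then show ?thesis by (simp add: dif_def chi_rot)
qed

text \<open>
  For \<open>i \<noteq> j\<close> this is a geometric sum whose ratio is an \<open>n\<close>-th root of unity other than \<open>1\<close>.
\<close>

lemma chi_orthogonal:
  "(\<Sum>k\<in>UNIV. chi i k * cnj (chi j k)) = (if i = j then of_nat CARD('n) else 0)"
  for i j :: "'n :: finite"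
proof (cases "i = j")
  case True
  then show ?thesis by (simp add: cnj_mult_self_unit)
next
  case False
  define z where "z = zeta TYPE('n) ^ pos i * cnj (zeta TYPE('n) ^ pos j)"
  have "z \<noteq> 1"
  proof
    assume "z = 1"
    then have "zeta TYPE('n) ^ pos i = zeta TYPE('n) ^ pos j"
      unfolding z_def
      by (metis cnj_mult_self_unit(1) mult.assoc mult.left_neutral mult.right_neutral norm_power norm_zeta power_one)
    then show False using zeta_power_inject[of "pos i" "pos j", where 'n='n] False by simp
  qed
  have "z ^ CARD('n) = (zeta TYPE('n) ^ CARD('n)) ^ pos i * cnj ((zeta TYPE('n) ^ CARD('n)) ^ pos j)"
    by (simp only: z_def power_mult_distrib complex_cnj_power power_mult[symmetric] mult.commute)
  then have "z ^ CARD('n) = 1" by (simp add: zeta_power_card)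
  have "(\<Sum>k\<in>(UNIV :: 'n set). chi i k * cnj (chi j k)) = (\<Sum>k\<in>(UNIV :: 'n set). z ^ pos k)"
    by (simp add: z_def chi_def power_mult power_mult_distrib)
  also have "\<dots> = (\<Sum>m<CARD('n). z ^ m)"
    by (rule sum.reindex_bij_betw[OF bij_pos])
  also have "\<dots> = 0"
    using \<open>z \<noteq> 1\<close> \<open>z ^ CARD('n) = 1\<close> by (simp add: geometric_sum)
  finally show ?thesis using False by simp
qed

text \<open>
  The characters of the group of words, that is, the tensor powers of the unnormalised Fourier
  matrix; the second word has to be at least as long as the first.
\<close>

definition wchi :: "'n list \<Rightarrow> 'n :: finite list \<Rightarrow> complex" where
  "wchi s b = (\<Prod>i<length s. chi (s ! i) (b ! i))"

lemma norm_wchi [simp]: "cmod (wchi s b) = 1"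
  by (simp add: wchi_def flip: prod_norm)

lemma sum_words_1: "(\<Sum>w\<in>words (Suc 0). f w) = (\<Sum>j\<in>UNIV. f [j])"
  by (rule sum.reindex_bij_witness[of _ "\<lambda>j. [j]" hd])
     (auto simp: words_def length_Suc_conv)

lemma sum_words_prod:
  fixes f :: "nat \<Rightarrow> 'n :: finite \<Rightarrow> complex"
  shows "(\<Sum>b\<in>words k. \<Prod>i<k. f i (b ! i)) = (\<Prod>i<k. \<Sum>j\<in>UNIV. f i j)"
proof (induction k)
  case 0
  then show ?case by (simp add: words_def)
next
  case (Suc k)
  have "(\<Sum>b\<in>words (Suc k). \<Prod>i<Suc k. f i (b ! i))
      = (\<Sum>p\<in>words k. \<Sum>j\<in>UNIV. \<Prod>i<Suc k. f i ((p @ [j]) ! i))"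
    using sum_words_add[of "\<lambda>b. \<Prod>i<Suc k. f i (b ! i)" k "Suc 0"] by (simp only: sum_words_1) simp
  also have "\<dots> = (\<Sum>p\<in>words k. \<Sum>j\<in>UNIV. (\<Prod>i<k. f i (p ! i)) * f k j)"
  proof (intro sum.cong refl)
    fix p :: "'n list" and j assume "p \<in> words k"
    then show "(\<Prod>i<Suc k. f i ((p @ [j]) ! i)) = (\<Prod>i<k. f i (p ! i)) * f k j"
      by (simp add: words_def nth_append)
  qed
  also have "\<dots> = (\<Sum>p\<in>words k. \<Prod>i<k. f i (p ! i)) * (\<Sum>j\<in>UNIV. f k j)"
    by (simp add: sum_product)
  finally show ?case by (simp add: Suc)
qed

text \<open>
  The sum over words is a product of sums over letters, one for each position.
\<close>

lemma wchi_orthogonal: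
  fixes s t :: "'n :: finite list"
  assumes "s \<in> words k" "t \<in> words k"
  shows "(\<Sum>b\<in>words k. wchi s b * cnj (wchi t b))
    = (if s = t then of_nat (CARD('n) ^ k) else 0)"
proof -
  have "(\<Sum>b\<in>words k. wchi s b * cnj (wchi t b))
      = (\<Sum>b\<in>words k. \<Prod>i<k. chi (s ! i) (b ! i) * cnj (chi (t ! i) (b ! i)))"
    using assms by (simp add: wchi_def words_def prod.distrib)
  also have "\<dots> = (\<Prod>i<k. \<Sum>j\<in>UNIV. chi (s ! i) j * cnj (chi (t ! i) j))"
    by (rule sum_words_prod)
  also have "\<dots> = (\<Prod>i<k. if s ! i = t ! i then of_nat CARD('n) else 0)"
    by (simp only: chi_orthogonal)
  also have "\<dots> = (if s = t then of_nat (CARD('n) ^ k) else 0)"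
  proof (cases "s = t")
    case False
    then obtain i where "i < k" "s ! i \<noteq> t ! i"
      using assms by (metis (mono_tags, lifting) mem_Collect_eq nth_equalityI words_def)
    then show ?thesis using False by (auto simp: prod_zero_iff)
  qed simp
  finally show ?thesis .
qed

definition twisted_fourier :: "('n \<Rightarrow> complex) \<Rightarrow> complex ^ 'n ^ 'n :: finite" where
  "twisted_fourier w = (\<chi> i j. w i * chi i j / complex_of_real (sqrt (real CARD('n))))"

lemma sqrt_card_square:
  "complex_of_real (sqrt (real CARD('n :: finite))) * complex_of_real (sqrt (real CARD('n))) = of_nat CARD('n)"
  by (metis abs_of_nat of_real_mult of_real_of_nat_eq real_sqrt_abs2 real_sqrt_mult_self)

lemma hadamard_twisted_fourier:
  fixes w :: "'n :: finite \<Rightarrow> complex"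
  assumes w: "\<And>i. cmod (w i) = 1"
  shows "hadamard_unitary (twisted_fourier w)"
proof -
  let ?q = "complex_of_real (sqrt (real CARD('n)))"
  have row: "(\<Sum>k\<in>UNIV. (w i * chi i k / ?q) * cnj (w j * chi j k / ?q)) = (if i = j then 1 else 0)"
    for i j
  proof -
    have "(\<Sum>k\<in>UNIV. (w i * chi i k / ?q) * cnj (w j * chi j k / ?q))
        = (\<Sum>k\<in>UNIV. (w i * cnj (w j) / (?q * ?q)) * (chi i k * cnj (chi j k)))"
      by (intro sum.cong refl) simp
    also have "\<dots> = (w i * cnj (w j) / (?q * ?q)) * (\<Sum>k\<in>UNIV. chi i k * cnj (chi j k))"
      by (simp only: sum_distrib_left)
    finally show ?thesis
      by (simp add: chi_orthogonal sqrt_card_square cnj_mult_self_unit w)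
  qed
  have col: "(\<Sum>k\<in>UNIV. cnj (w k * chi k i / ?q) * (w k * chi k j / ?q)) = (if i = j then 1 else 0)"
    for i j
  proof -
    have "(\<Sum>k\<in>UNIV. cnj (w k * chi k i / ?q) * (w k * chi k j / ?q))
        = (\<Sum>k\<in>UNIV. ((cnj (w k) * w k) / (?q * ?q)) * (chi j k * cnj (chi i k)))"
      by (intro sum.cong refl) (simp add: chi_commute)
    also have "\<dots> = (1 / (?q * ?q)) * (\<Sum>k\<in>UNIV. chi j k * cnj (chi i k))"
      by (simp only: sum_distrib_left cnj_mult_self_unit w)
    finally show ?thesis
      by (auto simp add: chi_orthogonal sqrt_card_square)
  qed
  show ?thesis
    using row col
    by (simp add: hadamard_unitary_def twisted_fourier_def matrix_matrix_mult_def mat_def vec_eq_iff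
        norm_divide norm_mult w)
qed


section \<open>Entries of the spin model unitaries\<close>

text \<open>
  The only nonzero entry of \<open>u\<^sub>1\<close> in row \<open>(a, b)\<close> and a column with first letter \<open>j\<close>; that column
  is \<open>(j, b)\<close> (\<open>spin_u1_entry\<close>).
\<close>

definition spin_weight :: "complex ^ 'n ^ 'n \<Rightarrow> 'n :: finite \<Rightarrow> 'n \<Rightarrow> 'n \<Rightarrow> complex" where
  "spin_weight u a b j = complex_of_real (sqrt (real CARD('n))) * u $ a $ j * cnj (u $ b $ j)"

lemma spin_D_entry:
  "spin_D u [a, b] [a', b'] =
    (if a = a' \<and> b = b' then complex_of_real (sqrt (real CARD('n))) * cnj (u $ b $ a) else 0)"
  for u :: "complex ^ 'n ^ 'n :: finite"
proof -
  have "(\<Sum>i\<in>UNIV. \<Sum>j\<in>UNIV. cnj (u $ i $ j) * wtensor 1 (matrix_unit j j) (matrix_unit i i) [a, b] [a', b'])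
      = (\<Sum>i\<in>UNIV. \<Sum>j\<in>UNIV. if j = a then (if i = b then (if a = a' \<and> b = b' then cnj (u $ i $ j) else 0) else 0) else 0)"
    by (intro sum.cong refl) (auto simp: wtensor_def matrix_unit_def)
  then show ?thesis
    by (simp add: spin_D_def)
qed

lemma sum_words_2: "(\<Sum>w\<in>words 2. f w) = (\<Sum>i\<in>UNIV. \<Sum>j\<in>(UNIV :: 'n :: finite set). f [i, j])"
  using sum_words_add[of f "Suc 0" "Suc 0"] by (simp add: sum_words_1 numeral_2_eq_2)

lemma spin_u1_entry:
  "spin_u1 u [a, b] [a', b'] = (if b = b' then spin_weight u a b a' else 0)"
  for u :: "complex ^ 'n ^ 'n :: finite"
proof -
  have "spin_u1 u [a, b] [a', b']
      = (\<Sum>i\<in>UNIV. \<Sum>j\<in>UNIV. if j = b then (if i = a' then (if b = b' then spin_weight u a b a' else 0) else 0) else 0)"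
    unfolding spin_u1_def wmult_def sum_words_2
    by (intro sum.cong refl)
       (auto simp: wtensor_def of_matrix_def wid_def spin_D_entry spin_weight_def)
  then show ?thesis by simp
qed

lemma take_drop_agree_iff:
  assumes "length s = Suc k" "length r = Suc k" "i < k"
  shows "take i s = take i r \<and> s ! Suc i = r ! Suc i \<and> drop 2 (drop i s) = drop 2 (drop i r)
    \<longleftrightarrow> r = s[i := r ! i]"
proof
  assume L: "take i s = take i r \<and> s ! Suc i = r ! Suc i \<and> drop 2 (drop i s) = drop 2 (drop i r)"
  show "r = s[i := r ! i]"
  proof (rule nth_equalityI)
    fix p assume p: "p < length r"
    consider "p < i" | "p = i" | "p = Suc i" | "p \<ge> i + 2" by linarith
    then show "r ! p = s[i := r ! i] ! p"
    proof cases
      case 1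
      then show ?thesis using L by (metis less_irrefl_nat nth_list_update_neq nth_take)
    next
      case 4
      then obtain q where q: "p = i + 2 + q" using le_iff_add by blast
      then have "r ! p = drop 2 (drop i r) ! q" "s ! p = drop 2 (drop i s) ! q"
        using assms p by simp_all
      then show ?thesis using L q by simp
    qed (use L assms in auto)
  qed (use assms in simp)
next
  assume r: "r = s[i := r ! i]"
  show "take i s = take i r \<and> s ! Suc i = r ! Suc i \<and> drop 2 (drop i s) = drop 2 (drop i r)"
    by (subst (1 2 3) r) (simp add: drop_drop)
qed

text \<open>
  The \<open>i\<close>-th factor only changes the \<open>i\<close>-th letter, so the sum over words collapses to a sum over
  the new letter.
\<close>

lemma spin_factor_apply:
  fixes u :: "complex ^ 'n ^ 'n :: finite"
  assumes s: "s \<in> words (Suc k)" and i: "i < k"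
  shows "wmult (Suc k) (wtensor i wid (wtensor 2 (spin_u1 u) wid)) Y s t
    = (\<Sum>j\<in>UNIV. spin_weight u (s ! i) (s ! Suc i) j * Y (s[i := j]) t)"
proof -
  let ?M = "wtensor i wid (wtensor 2 (spin_u1 u) wid)"
  have two: "take 2 (drop i r) = [r ! i, r ! Suc i]" if "r \<in> words (Suc k)" for r :: "'n list"
    using that i by (simp add: words_def numeral_2_eq_2 take_Suc_conv_app_nth)
  have M: "?M s r = (if r = s[i := r ! i] then spin_weight u (s ! i) (s ! Suc i) (r ! i) else 0)"
    if r: "r \<in> words (Suc k)" for r
    using take_drop_agree_iff[of s k r i] s r i
    by (auto simp: wtensor_def wid_def two spin_u1_entry words_def)
  have "wmult (Suc k) ?M Y s t = (\<Sum>r\<in>(\<lambda>j. s[i := j]) ` UNIV. ?M s r * Y r t)"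
    unfolding wmult_def
  proof (rule sum.mono_neutral_right)
    show "(\<lambda>j. s[i := j]) ` UNIV \<subseteq> words (Suc k)" using s by (auto simp: words_def)
    show "\<forall>r\<in>words (Suc k) - (\<lambda>j. s[i := j]) ` UNIV. ?M s r * Y r t = 0"
      using M by auto
  qed simp
  also have "\<dots> = (\<Sum>j\<in>UNIV. ?M s (s[i := j]) * Y (s[i := j]) t)"
  proof (rule sum.reindex[unfolded comp_def])
    show "inj (\<lambda>j. s[i := j])"
      using s i by (intro injI) (metis less_SucI mem_Collect_eq nth_list_update_eq words_def)
  qed
  also have "\<dots> = (\<Sum>j\<in>UNIV. spin_weight u (s ! i) (s ! Suc i) j * Y (s[i := j]) t)"
    using s i by (intro sum.cong refl) (subst M, auto simp: words_def)
  finally show ?thesis .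
qed

text \<open>
  Downward induction on \<open>i\<close>: the factors \<open>i, \<dots>, k - 1\<close> leave the letters before \<open>i\<close> and the last
  letter alone. Multiplying by one more factor on the left gives a sum over the new \<open>i\<close>-th letter,
  of which only the term with that letter equal to \<open>t ! i\<close> survives.
\<close>

lemma spin_unitary_partial:
  fixes u :: "complex ^ 'n ^ 'n :: finite"
  assumes "i \<le> k" "s \<in> words (Suc k)" "t \<in> words (Suc k)"
  shows "foldr (\<lambda>i. wmult (Suc k) (wtensor i wid (wtensor 2 (spin_u1 u) wid))) [i..<k] wid s t
    = (if \<forall>p\<le>k. p < i \<or> p = k \<longrightarrow> s ! p = t ! p
       then \<Prod>p=i..<k. spin_weight u (s ! p) (s ! Suc p) (t ! p) else 0)"
  using assms
proof (induction arbitrary: s t rule: inc_induct)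
  case base
  have "(\<forall>p\<le>k. p < k \<or> p = k \<longrightarrow> s ! p = t ! p) \<longleftrightarrow> s = t"
    using base by (auto simp: words_def list_eq_iff_nth_eq le_less less_Suc_eq)
  then show ?case by (simp add: wid_def)
next
  case (step i)
  let ?F = "\<lambda>i. foldr (\<lambda>i. wmult (Suc k) (wtensor i wid (wtensor 2 (spin_u1 u) wid))) [i..<k] wid"
  let ?C = "\<lambda>i s. \<forall>p\<le>k. p < i \<or> p = k \<longrightarrow> s ! p = t ! p"
  let ?P = "\<lambda>i s. \<Prod>p=i..<k. spin_weight u (s ! p) (s ! Suc p) (t ! p)"
  have len: "length s = Suc k" using step.prems by (simp add: words_def)
  have C: "?C (Suc i) (s[i := j]) \<longleftrightarrow> j = t ! i \<and> ?C i s" for j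
    using len step.hyps by (auto simp: nth_list_update less_Suc_eq dest: spec[of _ i])
  have P: "?P (Suc i) (s[i := j]) = ?P (Suc i) s" for j
    by (intro prod.cong refl) auto
  have "?F i s t = wmult (Suc k) (wtensor i wid (wtensor 2 (spin_u1 u) wid)) (?F (Suc i)) s t"
    using step.hyps by (simp add: upt_rec[of i k])
  also have "\<dots> = (\<Sum>j\<in>UNIV. spin_weight u (s ! i) (s ! Suc i) j * ?F (Suc i) (s[i := j]) t)"
    using step by (intro spin_factor_apply)
  also have "\<dots> = (\<Sum>j\<in>UNIV. if j = t ! i
      then (if ?C i s then spin_weight u (s ! i) (s ! Suc i) (t ! i) * ?P (Suc i) s else 0) else 0)"
  proof (intro sum.cong refl)
    fix j
    have delta: "f j * (if j = a \<and> b then q else 0) = (if j = a then (if b then f a * q else 0) else 0)"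
      for f :: "'n \<Rightarrow> complex" and a b q
      by simp
    have "s[i := j] \<in> words (Suc k)" using step.prems by (simp add: words_def)
    then have F: "?F (Suc i) (s[i := j]) t
        = (if ?C (Suc i) (s[i := j]) then ?P (Suc i) (s[i := j]) else 0)"
      using step.IH step.prems by blast
    show "spin_weight u (s ! i) (s ! Suc i) j * ?F (Suc i) (s[i := j]) t
        = (if j = t ! i then (if ?C i s then spin_weight u (s ! i) (s ! Suc i) (t ! i) * ?P (Suc i) s
             else 0) else 0)"
      unfolding F C P by (rule delta)
  qed
  also have "\<dots> = (if ?C i s then ?P i s else 0)"
    using step.hyps by (simp only: sum.delta finite UNIV_I if_True prod.atLeast_Suc_lessThan)
  finally show ?case .
qed

text \<open>
  The \<open>p\<close>-th factor turns \<open>s ! p\<close> into \<open>t ! p\<close> at a moment when the next letter is still that of \<open>s\<close>.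
  Hence a single path contributes to each entry, which is a product of weights instead of a sum.
\<close>

lemma spin_unitary_entry:
  fixes u :: "complex ^ 'n ^ 'n :: finite"
  assumes "s \<in> words (Suc k)" "t \<in> words (Suc k)"
  shows "spin_unitary u k s t
    = (if s ! k = t ! k then \<Prod>p<k. spin_weight u (s ! p) (s ! Suc p) (t ! p) else 0)"
  using spin_unitary_partial[of 0 k s t u] assms
  by (auto simp: spin_unitary_def lessThan_atLeast0)

text \<open>
  The last letter is carried along unchanged, which leaves a product of matrices on \<open>k\<close> letters.
\<close>

lemma spin_conjugate_entry:
  fixes u :: "complex ^ 'n ^ 'n :: finite" and x :: "'n wmat" and k :: nat
  defines "Z \<equiv> \<lambda>s r. \<Prod>p<k. spin_weight u (s ! p) (s ! Suc p) (r ! p)"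
  assumes s: "s \<in> words (Suc k)" and t: "t \<in> words (Suc k)"
  shows "wmult (Suc k) (wmult (Suc k) (spin_unitary u k) (wtensor k x wid))
      (wadj (spin_unitary u k)) s t
    = (if s ! k = t ! k then wmult k (wmult k Z x) (wadj Z) s t else 0)"
proof -
  have sum: "(\<Sum>r\<in>words (Suc k). f r) = (\<Sum>p\<in>words k. \<Sum>l\<in>UNIV. f (p @ [l]))"
    for f :: "'n list \<Rightarrow> complex"
    using sum_words_add[of f k "Suc 0"] by (simp add: sum_words_1)
  have U: "spin_unitary u k s (p @ [l]) = (if l = s ! k then Z s p else 0)"
    if "s \<in> words (Suc k)" "p \<in> words k" for s p l
  proof -
    have "(\<Prod>i<k. spin_weight u (s ! i) (s ! Suc i) ((p @ [l]) ! i)) = Z s p"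
      unfolding Z_def using that by (intro prod.cong refl) (simp add: words_def nth_append)
    then show ?thesis
      using that by (subst spin_unitary_entry) (auto simp: words_def nth_append)
  qed
  have inner: "wmult (Suc k) (spin_unitary u k) (wtensor k x wid) s (p' @ [l'])
      = (if l' = s ! k then wmult k Z x s p' else 0)" if "p' \<in> words k" for p' l'
  proof -
    have "wmult (Suc k) (spin_unitary u k) (wtensor k x wid) s (p' @ [l'])
        = (\<Sum>p\<in>words k. \<Sum>l\<in>UNIV. if l = s ! k then (if l' = s ! k then Z s p * x p p' else 0) else 0)"
      unfolding wmult_def sum using that
      by (intro sum.cong refl) (auto simp: U[OF s] wtensor_def wid_def words_def)
    then show ?thesis by (simp add: wmult_def)
  qed
  have "wmult (Suc k) (wmult (Suc k) (spin_unitary u k) (wtensor k x wid))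
      (wadj (spin_unitary u k)) s t
    = (\<Sum>p\<in>words k. \<Sum>l\<in>UNIV.
        wmult (Suc k) (spin_unitary u k) (wtensor k x wid) s (p @ [l]) * cnj (spin_unitary u k t (p @ [l])))"
    by (subst wmult_def) (simp only: sum wadj_def)
  also have "\<dots> = (\<Sum>p\<in>words k. \<Sum>l\<in>UNIV. if l = s ! k
      then (if s ! k = t ! k then wmult k Z x s p * cnj (Z t p) else 0) else 0)"
    by (intro sum.cong refl) (simp add: inner U[OF t])
  also have "\<dots> = (if s ! k = t ! k then wmult k (wmult k Z x) (wadj Z) s t else 0)"
    by (simp add: wmult_def[of k "wmult k Z x"] wadj_def)
  finally show ?thesis .
qed


section \<open>The spin algebras of twisted Fourier matrices\<close>

definition difs :: "'n :: finite list \<Rightarrow> 'n list" where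
  "difs s = map2 dif s (tl s)"

lemma difs_in_words: "s \<in> words (Suc k) \<Longrightarrow> difs s \<in> words k"
  by (simp add: difs_def words_def)

lemma nth_difs: "s \<in> words (Suc k) \<Longrightarrow> p < k \<Longrightarrow> difs s ! p = dif (s ! p) (s ! Suc p)"
  by (simp add: difs_def words_def nth_tl)

lemma difs_rot: "difs (map (rot m) s) = difs s"
  by (simp add: difs_def map_tl[symmetric] zip_map_map case_prod_beta' dif_rot)

text \<open>
  The word with prescribed differences whose last letter is \<open>letter 0\<close>. Every word with these
  differences is a rotation of it (\<open>undifs_difs\<close>).
\<close>

fun undifs :: "'n :: finite list \<Rightarrow> 'n list" where
  "undifs [] = [letter 0]"
| "undifs (d # ds) = rot (pos (hd (undifs ds))) d # undifs ds"

lemma undifs_difs: "s \<noteq> [] \<Longrightarrow> undifs (difs s) = map (rot (CARD('n) - pos (last s))) s"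
  for s :: "'n :: finite list"
proof (induction s rule: induct_list012)
  case (2 i)
  have "pos (rot (CARD('n) - pos i) i) = 0"
    by (simp add: pos_rot less_imp_le)
  then have "rot (CARD('n) - pos i) i = letter 0"
    by (simp add: pos_letter flip: pos_inject)
  then show ?case by (simp add: difs_def)
next
  case (3 i j s)
  have "undifs (difs (i # j # s)) = rot (pos (hd (undifs (difs (j # s))))) (dif i j) # undifs (difs (j # s))"
    by (simp add: difs_def)
  then show ?case by (simp add: 3 rot_pos_dif)
qed simp

lemma telescope_unimodular:
  fixes w :: "'n \<Rightarrow> complex"
  assumes "\<And>i. cmod (w i) = 1"
  shows "(\<Prod>p<k. w (s ! p) * cnj (w (s ! Suc p))) = w (s ! 0) * cnj (w (s ! k))"
proof (induction k)
  case 0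
  then show ?case by (simp add: cnj_mult_self_unit assms)
next
  case (Suc k)
  have "(\<Prod>p<Suc k. w (s ! p) * cnj (w (s ! Suc p)))
      = w (s ! 0) * (cnj (w (s ! k)) * w (s ! k)) * cnj (w (s ! Suc k))"
    by (simp add: Suc)
  then show ?case by (simp add: cnj_mult_self_unit assms)
qed

lemma spin_weight_twisted_fourier:
  "spin_weight (twisted_fourier w) a b j
    = w a * cnj (w b) * chi (dif a b) j / complex_of_real (sqrt (real CARD('n)))"
  for w :: "'n :: finite \<Rightarrow> complex"
  by (simp add: spin_weight_def twisted_fourier_def chi_dif)

lemma twisted_fourier_weights:
  fixes w :: "'n :: finite \<Rightarrow> complex"
  assumes w: "\<And>i. cmod (w i) = 1" and s: "s \<in> words (Suc k)"
  shows "(\<Prod>p<k. spin_weight (twisted_fourier w) (s ! p) (s ! Suc p) (r ! p))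
    = w (hd s) * cnj (w (s ! k)) * wchi (difs s) r / complex_of_real (sqrt (real CARD('n))) ^ k"
proof -
  have "length (difs s) = k" using difs_in_words[OF s] by (simp add: words_def)
  moreover have "hd s = s ! 0" using s by (cases s) (auto simp: words_def)
  moreover have "(\<Prod>p<k. chi (dif (s ! p) (s ! Suc p)) (r ! p)) = (\<Prod>p<k. chi (difs s ! p) (r ! p))"
    by (intro prod.cong refl) (simp add: nth_difs[OF s])
  moreover have "(\<Prod>p<k. spin_weight (twisted_fourier w) (s ! p) (s ! Suc p) (r ! p))
      = (\<Prod>p<k. w (s ! p) * cnj (w (s ! Suc p))) * (\<Prod>p<k. chi (dif (s ! p) (s ! Suc p)) (r ! p))
        / complex_of_real (sqrt (real CARD('n))) ^ k"
    unfolding spin_weight_twisted_fourier prod_dividef prod.distrib by simp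
  moreover have "(\<Prod>p<k. w (s ! p) * cnj (w (s ! Suc p))) = w (s ! 0) * cnj (w (s ! k))"
    using w by (rule telescope_unimodular)
  ultimately show ?thesis
    by (simp only: wchi_def)
qed

text \<open>
  The character matrix \<open>G\<close> satisfies \<open>G G\<^sup>* = c\<close> with \<open>c = n\<^sup>k\<close>, so \<open>x = G\<^sup>* y G / c\<^sup>2\<close> is a preimage of \<open>y\<close>.
\<close>

lemma wchi_conjugation_surj:
  fixes y :: "('n :: finite) wmat"
  shows "\<exists>x. \<forall>p\<in>words k. \<forall>q\<in>words k. wmult k (wmult k wchi x) (wadj wchi) p q = y p q"
proof -
  define c where "c = (of_nat (CARD('n) ^ k) :: complex)"
  have c: "c \<noteq> 0" by (simp add: c_def)
  have G: "wmult k wchi (wadj wchi) p q = (if p = q then c else 0)"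
    if "p \<in> words k" "q \<in> words k" for p q :: "'n list"
    unfolding wmult_def wadj_def c_def by (rule wchi_orthogonal[OF that])
  define y' where "y' = (\<lambda>p q. y p q / (c * c))"
  define x where "x = wmult k (wmult k (wadj wchi) y') wchi"
  have right: "(\<Sum>r\<in>words k. f r * (if r = q then c else 0)) = f q * c"
    and left: "(\<Sum>r\<in>words k. (if q = r then c else 0) * f r) = c * f q"
    if "q \<in> words k" for f and q :: "'n list"
  proof -
    have "(\<Sum>r\<in>words k. f r * (if r = q then c else 0)) = (\<Sum>r\<in>words k. if r = q then f q * c else 0)"
      by (intro sum.cong refl) auto
    then show "(\<Sum>r\<in>words k. f r * (if r = q then c else 0)) = f q * c" using that by simp
    have "(\<Sum>r\<in>words k. (if q = r then c else 0) * f r) = (\<Sum>r\<in>words k. if r = q then c * f q else 0)"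
      by (intro sum.cong refl) auto
    then show "(\<Sum>r\<in>words k. (if q = r then c else 0) * f r) = c * f q" using that by simp
  qed
  have "wmult k (wmult k wchi x) (wadj wchi) p q = y p q" if pq: "p \<in> words k" "q \<in> words k" for p q
  proof -
    let ?H = "wmult k wchi (wadj wchi)"
    have "wmult k (wmult k wchi x) (wadj wchi) p q = wmult k (wmult k ?H y') ?H p q"
      by (simp only: x_def wmult_assoc)
    moreover have "wmult k (wmult k ?H y') ?H p q = wmult k ?H y' p q * c"
    proof -
      have "wmult k (wmult k ?H y') ?H p q = (\<Sum>r\<in>words k. wmult k ?H y' p r * (if r = q then c else 0))"
        unfolding wmult_def[of k "wmult k ?H y'"]
        by (intro sum.cong refl) (simp only: G pq)
      then show ?thesis by (simp only: right[OF pq(2)])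
    qed
    moreover have "wmult k ?H y' p q = c * y' p q"
    proof -
      have "wmult k ?H y' p q = (\<Sum>r\<in>words k. (if p = r then c else 0) * y' r q)"
        unfolding wmult_def[of k ?H]
        by (intro sum.cong refl) (simp only: G pq)
      then show ?thesis by (simp only: left[OF pq(1)])
    qed
    ultimately show ?thesis using c by (simp add: y'_def)
  qed
  then show ?thesis by blast
qed

text \<open>
  A diagonal factor \<open>c\<close> and a relabelling \<open>d\<close> of the rows pull out of a conjugation.
\<close>

lemma wmult_rescaled_conjugate:
  assumes "\<And>s r. Z s r = c s * G (d s) r"
  shows "wmult k (wmult k Z x) (wadj Z) s t
    = c s * cnj (c t) * wmult k (wmult k G x) (wadj G) (d s) (d t)"
proof -
  have 1: "wmult k Z x s r = c s * wmult k G x (d s) r" for s r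
    by (simp add: wmult_def assms sum_distrib_left mult.assoc)
  show ?thesis
    by (simp add: wmult_def[of k "wmult k Z x"] wmult_def[of k "wmult k G x"] 1 wadj_def assms
        sum_distrib_left mult_ac)
qed

text \<open>
  By \<open>twisted_fourier_weights\<close> the matrix that conjugates is \<open>w(s\<^sub>1) w(s\<^bsub>k+1\<^esub>)\<^sup>*\<close> times a character of the
  difference word. The factors of the last letter cancel since that letter is shared, and
  every matrix \<open>y\<close> arises because conjugation by the characters is surjective.
\<close>

lemma spin_algebra_twisted_fourier:
  fixes w :: "'n :: finite \<Rightarrow> complex"
  assumes w: "\<And>i. cmod (w i) = 1"
  shows "spin_algebra (twisted_fourier w) k
    = {of_wmat (Suc k) (\<lambda>s t. if s ! k = t ! k
         then w (hd s) * cnj (w (hd t)) * y (difs s) (difs t) else 0) | y. True}"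
    (is "_ = {of_wmat _ (?B y) | y. True}")
proof -
  define q where "q = complex_of_real (sqrt (real CARD('n))) ^ k"
  have q: "cnj q = q" "q * q \<noteq> 0" by (simp_all add: q_def)
  let ?U = "spin_unitary (twisted_fourier w) k"
  let ?A = "\<lambda>x. of_wmat (Suc k) (wmult (Suc k) (wmult (Suc k) ?U (wtensor k x wid)) (wadj ?U))"
  define Y where "Y x = (\<lambda>p p'. wmult k (wmult k wchi x) (wadj wchi) p p' / (q * q))" for x :: "'n wmat"
  have "?A x = of_wmat (Suc k) (?B (Y x))" for x
  proof (rule of_wmat_cong)
    fix s t :: "'n list" assume s: "s \<in> words (Suc k)" and t: "t \<in> words (Suc k)"
    define c where "c s = w (hd s) * cnj (w (s ! k)) / q" for s :: "'n list"
    define Z where "Z s r = c s * wchi (difs s) r" for s r :: "'n list"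
    have Z: "wmult k (wmult k Z x) (wadj Z) s t = w (hd s) * cnj (w (hd t)) * Y x (difs s) (difs t)"
      if "s ! k = t ! k"
    proof -
      have "c s * cnj (c t) = w (hd s) * cnj (w (hd t)) * (cnj (w (s ! k)) * w (s ! k)) / (q * q)"
        by (simp add: c_def that q(1))
      then have "c s * cnj (c t) = w (hd s) * cnj (w (hd t)) / (q * q)"
        by (simp only: cnj_mult_self_unit(1)[OF w] mult_1_right)
      then show ?thesis
        unfolding wmult_rescaled_conjugate[of Z c wchi difs, OF Z_def] Y_def by simp
    qed
    have prod: "(\<Prod>p<k. spin_weight (twisted_fourier w) (s ! p) (s ! Suc p) (r ! p)) = Z s r"
      if "s \<in> words (Suc k)" for s r
      unfolding Z_def c_def q_def by (simp add: twisted_fourier_weights[OF w that])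
    have "wmult (Suc k) (wmult (Suc k) ?U (wtensor k x wid)) (wadj ?U) s t
        = (if s ! k = t ! k then wmult k (wmult k Z x) (wadj Z) s t else 0)"
      unfolding spin_conjugate_entry[OF s t]
      by (simp only: prod[OF s] prod[OF t] wmult_def wadj_def)
    then show "wmult (Suc k) (wmult (Suc k) ?U (wtensor k x wid)) (wadj ?U) s t = ?B (Y x) s t"
      using Z by simp
  qed
  then have 1: "spin_algebra (twisted_fourier w) k = {of_wmat (Suc k) (?B (Y x)) | x. True}"
    unfolding spin_algebra_def Suc_eq_plus1[symmetric] by (simp only:)
  have 2: "\<exists>x. of_wmat (Suc k) (?B y) = of_wmat (Suc k) (?B (Y x))" for y
  proof -
    obtain x where x: "\<And>p p'. p \<in> words k \<Longrightarrow> p' \<in> words k \<Longrightarrow>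
        wmult k (wmult k wchi x) (wadj wchi) p p' = q * q * y p p'"
      using wchi_conjugation_surj[of k "\<lambda>p p'. q * q * y p p'"] by blast
    have "Y x p p' = y p p'" if "p \<in> words k" "p' \<in> words k" for p p'
      unfolding Y_def x[OF that] using q(2) by (rule nonzero_mult_div_cancel_left)
    then have "of_wmat (Suc k) (?B y) = of_wmat (Suc k) (?B (Y x))"
      by (intro of_wmat_cong) (simp only: difs_in_words)
    then show ?thesis by blast
  qed
  show ?thesis unfolding 1 using 2 by blast
qed


section \<open>Eigenspaces of the rotation automorphism\<close>

text \<open>
  The entries of \<open>W\<^sup>* x W\<close>, where \<open>W\<close> is the diagonal matrix of \<open>w\<close> in the first tensor factor.
\<close>

definition twist :: "('n \<Rightarrow> complex) \<Rightarrow> 'n uhf \<Rightarrow> (nat \<Rightarrow> 'n) \<Rightarrow> (nat \<Rightarrow> 'n) \<Rightarrow> complex" where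
  "twist w x s t = cnj (w (s 0)) * Rep_uhf x s t * w (t 0)"

text \<open>
  The eigenspace for \<open>z\<close> of the automorphism that conjugates by \<open>W\<close> the simultaneous rotation of all
  letters of the infinite words. Stating it for all powers \<open>m\<close> saves iterating the rotation.
\<close>

definition eigenspace :: "('n :: finite \<Rightarrow> complex) \<Rightarrow> complex \<Rightarrow> 'n uhf set" where
  "eigenspace w z = {x. \<forall>m s t. twist w x (rot m \<circ> s) (rot m \<circ> t) = z ^ m * twist w x s t}"

text \<open>
  The condition under which an entry of the kernel of a matrix on \<open>k\<close> letters can be nonzero.
\<close>

definition tail_eq :: "nat \<Rightarrow> (nat \<Rightarrow> 'n) \<Rightarrow> (nat \<Rightarrow> 'n) \<Rightarrow> bool" where
  "tail_eq k s t \<longleftrightarrow> (\<forall>i\<ge>k. s i = t i)"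

lemma tail_eq_rot: "tail_eq k (rot m \<circ> s) (rot m \<circ> t) \<longleftrightarrow> tail_eq k s (t :: nat \<Rightarrow> 'n :: finite)"
  by (simp add: tail_eq_def)

lemma Rep_uhf_of_wmat:
  "Rep_uhf (of_wmat k p) s t = (if tail_eq k s t then p (map s [0..<k]) (map t [0..<k]) else 0)"
  unfolding of_wmat.rep_eq wmat_kernel_def tail_eq_def by (rule refl)

lemma twist_of_wmat:
  assumes w: "\<And>i. cmod (w i) = 1" and k: "0 < k"
  shows "twist w (of_wmat k (\<lambda>s t. w (hd s) * cnj (w (hd t)) * M s t)) s t
    = (if tail_eq k s t then M (map s [0..<k]) (map t [0..<k]) else 0)"
proof -
  have hd: "hd (map f [0..<k]) = f 0" for f :: "nat \<Rightarrow> 'a"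
    using k by (simp add: hd_map)
  have "cnj a * (a * cnj b * c) * b = (cnj a * a) * (cnj b * b) * c" for a b c :: complex
    by (simp add: mult_ac)
  then show ?thesis
    by (simp add: twist_def Rep_uhf_of_wmat hd cnj_mult_self_unit w)
qed

text \<open>
  The outer factors undo the conjugation by \<open>W\<close>, so only the behaviour of \<open>M\<close> under rotation matters.
\<close>

lemma of_wmat_in_eigenspace:
  fixes w :: "'n :: finite \<Rightarrow> complex"
  assumes w: "\<And>i. cmod (w i) = 1" and k: "0 < k"
    and M: "\<And>m s t. s \<in> words k \<Longrightarrow> t \<in> words k \<Longrightarrow> M (map (rot m) s) (map (rot m) t) = z ^ m * M s t"
  shows "of_wmat k (\<lambda>s t. w (hd s) * cnj (w (hd t)) * M s t) \<in> eigenspace w z"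
proof -
  have word: "map s [0..<k] \<in> words k" for s :: "nat \<Rightarrow> 'n"
    by (simp add: words_def)
  have "M (map (rot m \<circ> s) [0..<k]) (map (rot m \<circ> t) [0..<k])
      = z ^ m * M (map s [0..<k]) (map t [0..<k])" for m s t
    using M[OF word word, of m s t] by (simp only: map_map)
  moreover have "twist w (of_wmat k (\<lambda>s t. w (hd s) * cnj (w (hd t)) * M s t)) s t
      = (if tail_eq k s t then M (map s [0..<k]) (map t [0..<k]) else 0)" for s t
    by (rule twist_of_wmat[OF w k])
  ultimately show ?thesis
    by (simp only: eigenspace_def mem_Collect_eq tail_eq_rot) simp
qed

text \<open>
  The same condition read off at finite words, which are extended to infinite ones by an arbitrary
  constant letter.
\<close>

lemma eigenspace_entry:
  fixes w :: "'n :: finite \<Rightarrow> complex"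
  assumes x: "of_wmat k p \<in> eigenspace w z" and k: "0 < k"
    and s: "s \<in> words k" and t: "t \<in> words k"
  shows "cnj (w (rot m (hd s))) * p (map (rot m) s) (map (rot m) t) * w (rot m (hd t))
    = z ^ m * (cnj (w (hd s)) * p s t * w (hd t))"
proof -
  define g where "g s = (\<lambda>i. if i < k then s ! i else undefined)" for s :: "'n list"
  have g: "map (g s) [0..<k] = s" "g s 0 = hd s" if "s \<in> words k" for s
    using that k by (auto simp: g_def words_def hd_conv_nth intro: nth_equalityI)
  have rg: "map (rot m \<circ> g s) [0..<k] = map (rot m) s" if "s \<in> words k" for s
    using g(1)[OF that] by (metis map_map)
  have "twist w (of_wmat k p) (rot m \<circ> g s) (rot m \<circ> g t) = z ^ m * twist w (of_wmat k p) (g s) (g t)"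
    using x by (simp add: eigenspace_def)
  moreover have "tail_eq k (g s) (g t)"
    by (simp add: tail_eq_def g_def)
  ultimately show ?thesis
    using g[OF s] g[OF t] rg[OF s] rg[OF t]
    by (simp only: twist_def Rep_uhf_of_wmat tail_eq_rot if_True o_apply)
qed

lemma twist_times:
  fixes w :: "'n :: finite \<Rightarrow> complex"
  assumes w: "\<And>i. cmod (w i) = 1"
  shows "twist w (x * y) s t = (\<Sum>r | twist w x s r \<noteq> 0. twist w x s r * twist w y r t)"
proof -
  have nz: "w i \<noteq> 0" for i using w[of i] by auto
  have "twist w (x * y) s t
      = (\<Sum>r | Rep_uhf x s r \<noteq> 0. cnj (w (s 0)) * (Rep_uhf x s r * Rep_uhf y r t) * w (t 0))"
    by (simp add: twist_def times_uhf.rep_eq sum_distrib_left sum_distrib_right)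
  also have "\<dots> = (\<Sum>r | twist w x s r \<noteq> 0. twist w x s r * twist w y r t)"
  proof (rule sum.cong)
    show "{r. Rep_uhf x s r \<noteq> 0} = {r. twist w x s r \<noteq> 0}" by (simp add: twist_def nz)
    fix r
    have "twist w x s r * twist w y r t
        = cnj (w (s 0)) * (Rep_uhf x s r * Rep_uhf y r t) * w (t 0) * (w (r 0) * cnj (w (r 0)))"
      by (simp add: twist_def mult_ac)
    then show "cnj (w (s 0)) * (Rep_uhf x s r * Rep_uhf y r t) * w (t 0)
        = twist w x s r * twist w y r t"
      by (simp add: cnj_mult_self_unit w)
  qed
  finally show ?thesis .
qed

text \<open>
  Rotation permutes the words over which the matrix product sums. The eigenvalue has to be nonzero
  for it to map the support of one row of \<open>x\<close> onto that of the rotated row.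
\<close>

lemma eigenspace_times:
  fixes w :: "'n :: finite \<Rightarrow> complex"
  assumes w: "\<And>i. cmod (w i) = 1" and z: "z \<noteq> 0"
    and x: "x \<in> eigenspace w z" and y: "y \<in> eigenspace w z'"
  shows "x * y \<in> eigenspace w (z * z')"
  unfolding eigenspace_def
proof (intro CollectI allI)
  fix m and s t :: "nat \<Rightarrow> 'n"
  let ?R = "\<lambda>r :: nat \<Rightarrow> 'n. rot m \<circ> r"
  have X: "twist w x (?R s) (?R r) = z ^ m * twist w x s r" for s r
    using x by (simp add: eigenspace_def)
  have Y: "twist w y (?R s) (?R r) = z' ^ m * twist w y s r" for s r
    using y by (simp add: eigenspace_def)
  have bij: "bij ?R"
  proof (rule bij_betw_byWitness[where f' = "\<lambda>r. inv (rot m) \<circ> r"])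
    show "\<forall>r\<in>UNIV. inv (rot m) \<circ> ?R r = r"
      by (simp add: fun_eq_iff inv_f_f[OF bij_is_inj[OF bij_rot]])
    show "\<forall>r\<in>UNIV. ?R (inv (rot m) \<circ> r) = r"
      by (simp add: fun_eq_iff surj_f_inv_f[OF bij_is_surj[OF bij_rot]])
  qed auto
  have "twist w (x * y) (?R s) (?R t)
      = (\<Sum>r\<in>?R ` {r. twist w x s r \<noteq> 0}. twist w x (?R s) r * twist w y r (?R t))"
    unfolding twist_times[OF w]
  proof (rule sum.cong)
    have "{r. twist w x (?R s) r \<noteq> 0} = ?R ` {r. twist w x (?R s) (?R r) \<noteq> 0}"
      using surj_image_vimage_eq[of ?R "{r. twist w x (?R s) r \<noteq> 0}"] bij
      by (simp add: vimage_def bij_def)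
    then show "{r. twist w x (?R s) r \<noteq> 0} = ?R ` {r. twist w x s r \<noteq> 0}"
      using z by (simp add: X)
  qed simp
  also have "\<dots> = (\<Sum>r | twist w x s r \<noteq> 0. twist w x (?R s) (?R r) * twist w y (?R r) (?R t))"
    using bij by (subst sum.reindex) (auto simp: bij_def intro: inj_on_subset)
  also have "\<dots> = (z * z') ^ m * twist w (x * y) s t"
    by (simp add: X Y twist_times[OF w] sum_distrib_left power_mult_distrib mult_ac)
  finally show "twist w (x * y) (?R s) (?R t) = (z * z') ^ m * twist w (x * y) s t" .
qed

lemma eigenspace_uadj:
  assumes "x \<in> eigenspace w z"
  shows "uadj x \<in> eigenspace w (cnj z)"
proof -
  have "twist w (uadj x) s t = cnj (twist w x t s)" for s t
    by (simp add: twist_def uadj.rep_eq mult_ac)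
  then show ?thesis using assms by (simp add: eigenspace_def)
qed

lemma eigenspace_conjugate:
  fixes w :: "'n :: finite \<Rightarrow> complex"
  assumes w: "\<And>i. cmod (w i) = 1" and z: "cmod z = 1" and v: "v \<in> eigenspace w z"
    and x: "x \<in> eigenspace w 1"
  shows "v * x * uadj v \<in> eigenspace w 1" "uadj v * x * v \<in> eigenspace w 1"
proof -
  have nz: "z \<noteq> 0" using z by auto
  have "v * x * uadj v \<in> eigenspace w (z * 1 * cnj z)"
    using nz by (intro eigenspace_times w v x eigenspace_uadj) auto
  then show "v * x * uadj v \<in> eigenspace w 1" by (simp add: cnj_mult_self_unit z)
  have "uadj v * x * v \<in> eigenspace w (cnj z * 1 * z)"
    using nz by (intro eigenspace_times w v x eigenspace_uadj) auto
  then show "uadj v * x * v \<in> eigenspace w 1" by (simp add: cnj_mult_self_unit z)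
qed

lemma spin_algebra_subset_eigenspace:
  fixes w :: "'n :: finite \<Rightarrow> complex"
  assumes w: "\<And>i. cmod (w i) = 1"
  shows "spin_algebra (twisted_fourier w) k \<subseteq> eigenspace w 1"
proof
  fix x assume "x \<in> spin_algebra (twisted_fourier w) k"
  then obtain y where x: "x = of_wmat (Suc k) (\<lambda>s t. if s ! k = t ! k
      then w (hd s) * cnj (w (hd t)) * y (difs s) (difs t) else 0)"
    unfolding spin_algebra_twisted_fourier[OF w] by blast
  define M where "M s t = (if s ! k = t ! k then y (difs s) (difs t) else 0)" for s t
  have "x = of_wmat (Suc k) (\<lambda>s t. w (hd s) * cnj (w (hd t)) * M s t)"
    unfolding x by (rule of_wmat_cong) (simp add: M_def)
  also have "\<dots> \<in> eigenspace w 1"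
    by (rule of_wmat_in_eigenspace[OF w]) (auto simp: M_def words_def difs_rot)
  finally show "x \<in> eigenspace w 1" .
qed

text \<open>
  A fixed point on \<open>k\<close> letters is regarded as one on \<open>k + 1\<close> letters that carries the last letter along.
  Rotating all letters until the last one becomes \<open>letter 0\<close> does not change its entries and
  turns the words into \<open>undifs\<close> of their differences, so the entries depend on the differences only.
\<close>

lemma eigenspace_subset_spin_algebras:
  fixes w :: "'n :: finite \<Rightarrow> complex"
  assumes w: "\<And>i. cmod (w i) = 1" and x: "x \<in> eigenspace w 1"
  shows "\<exists>k\<ge>1. x \<in> spin_algebra (twisted_fourier w) k"
proof -
  obtain l q where "x = of_wmat l q" using uhf_exhaust by blast
  then obtain p where p: "x = of_wmat (Suc l) p" using of_wmat_mono[of l "Suc l" q] by auto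
  let ?k = "Suc l"
  define y where "y d e = cnj (w (hd (undifs d))) * p (butlast (undifs d)) (butlast (undifs e))
      * w (hd (undifs e))" for d e
  have "x = of_wmat (?k + 1) (wtensor ?k p wid)"
    unfolding p by (rule of_wmat_tensor[symmetric])
  also have "\<dots> = of_wmat (Suc ?k) (\<lambda>s t. if s ! ?k = t ! ?k
      then w (hd s) * cnj (w (hd t)) * y (difs s) (difs t) else 0)"
    unfolding Suc_eq_plus1[symmetric]
  proof (rule of_wmat_cong)
    fix s t :: "'n list" assume s: "s \<in> words (Suc ?k)" and t: "t \<in> words (Suc ?k)"
    have drop: "drop ?k s = [s ! ?k]" if "s \<in> words (Suc ?k)" for s :: "'n list"
      using that by (simp add: words_def Cons_nth_drop_Suc[symmetric])
    have last: "last s = s ! ?k" if "s \<in> words (Suc ?k)" for s :: "'n list"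
      using that by (cases s) (auto simp: words_def last_conv_nth)
    have ne: "s \<noteq> []" if "s \<in> words (Suc ?k)" for s :: "'n list"
      using that by (auto simp: words_def)
    have hd: "hd (map f s) = f (hd (take ?k s))" "hd s = hd (take ?k s)"
      if "s \<in> words (Suc ?k)" for s :: "'n list" and f :: "'n \<Rightarrow> 'n"
      using ne[OF that] by (simp_all add: hd_map)
    have butlast: "butlast (map f s) = map f (take ?k s)"
      if "s \<in> words (Suc ?k)" for s :: "'n list" and f :: "'n \<Rightarrow> 'n"
      using that by (simp add: words_def butlast_conv_take take_map)
    have tk: "take ?k s \<in> words ?k" if "s \<in> words (Suc ?k)" for s :: "'n list"
      using that by (simp add: words_def)
    show "wtensor ?k p wid s t = (if s ! ?k = t ! ?k
        then w (hd s) * cnj (w (hd t)) * y (difs s) (difs t) else 0)"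
    proof (cases "s ! ?k = t ! ?k")
      case True
      \<comment> \<open>The rotation that takes the common last letter to \<open>letter 0\<close>.\<close>
      let ?m = "CARD('n) - pos (t ! ?k)"
      have "y (difs s) (difs t)
          = cnj (w (rot ?m (hd (take ?k s)))) * p (map (rot ?m) (take ?k s)) (map (rot ?m) (take ?k t))
            * w (rot ?m (hd (take ?k t)))"
        unfolding y_def undifs_difs[OF ne[OF s]] undifs_difs[OF ne[OF t]] last[OF s] last[OF t] True
        by (simp only: hd(1)[OF s] hd(1)[OF t] butlast[OF s] butlast[OF t])
      also have "\<dots> = cnj (w (hd s)) * p (take ?k s) (take ?k t) * w (hd t)"
        unfolding hd(2)[OF s] hd(2)[OF t]
        using eigenspace_entry[OF x[unfolded p] _ tk[OF s] tk[OF t], of ?m] by simp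
      finally have "w (hd s) * cnj (w (hd t)) * y (difs s) (difs t)
          = (w (hd s) * cnj (w (hd s))) * (w (hd t) * cnj (w (hd t))) * p (take ?k s) (take ?k t)"
        by (simp add: mult_ac)
      then show ?thesis
        using True by (simp add: wtensor_def wid_def drop[OF s] drop[OF t] cnj_mult_self_unit w)
    next
      case False
      then show ?thesis by (simp add: wtensor_def wid_def drop[OF s] drop[OF t])
    qed
  qed
  finally have "x \<in> spin_algebra (twisted_fourier w) ?k"
    unfolding spin_algebra_twisted_fourier[OF w] by blast
  then show ?thesis by (intro exI[of _ ?k]) simp
qed

lemma spin_subfactor_twisted_fourier:
  fixes w :: "'n :: finite \<Rightarrow> complex"
  assumes w: "\<And>i. cmod (w i) = 1"
  shows "spin_subfactor (twisted_fourier w) = wot closure_of gns_rep ` eigenspace w 1"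
proof -
  have "(\<Union>k\<in>{1..}. gns_rep ` spin_algebra (twisted_fourier w) k) = gns_rep ` eigenspace w 1"
    using spin_algebra_subset_eigenspace[OF w] eigenspace_subset_spin_algebras[OF w] by fastforce
  then show ?thesis by (simp only: spin_subfactor_def)
qed


section \<open>Weyl unitaries and regularity\<close>

text \<open>
  Translation of words by \<open>a\<close> followed by multiplication with the character \<open>b\<close>, conjugated by \<open>W\<close>.
\<close>

definition weyl :: "('n :: finite \<Rightarrow> complex) \<Rightarrow> nat \<Rightarrow> 'n list \<Rightarrow> 'n list \<Rightarrow> 'n uhf" where
  "weyl w k a b = of_wmat k (\<lambda>s t. w (hd s) * cnj (w (hd t))
     * (if t = map2 dif s a then wchi s b else 0))"

lemma dif_eq_iff: "j = dif i d \<longleftrightarrow> d = dif i (j :: 'n :: finite)"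
proof -
  have "j = dif i d \<longleftrightarrow> (pos j + pos d) mod CARD('n) = pos i" for j d :: 'n
    using rot_pos_dif[of 0 d i] by (metis pos_rot pos_inject rot_inject rot_zero)
  then show ?thesis by (metis add.commute)
qed

lemma map2_dif_eq_iff:
  "s \<in> words k \<Longrightarrow> t \<in> words k \<Longrightarrow> a \<in> words k \<Longrightarrow> t = map2 dif s a \<longleftrightarrow> a = map2 dif s t"
  by (auto simp: words_def list_eq_iff_nth_eq dif_eq_iff[symmetric])

lemma bij_map2_dif: "a \<in> words k \<Longrightarrow> bij_betw (\<lambda>s. map2 dif s a) (words k) (words k)"
proof -
  assume a: "a \<in> words k"
  have "inj_on (\<lambda>s. map2 dif s a) (words k)"
    using a by (intro inj_onI) (auto simp: words_def list_eq_iff_nth_eq dif_def)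
  moreover have "(\<lambda>s. map2 dif s a) ` words k \<subseteq> words k"
    using a by (auto simp: words_def)
  ultimately show ?thesis by (simp add: bij_betw_def endo_inj_surj)
qed

lemma unitary_uhf_weighted_permutation:
  fixes h :: "('n :: finite) list \<Rightarrow> 'n list"
  assumes h: "bij_betw h (words k) (words k)" and f: "\<And>s. s \<in> words k \<Longrightarrow> cmod (f s) = 1"
  shows "unitary_uhf (of_wmat k (\<lambda>s t. if t = h s then f s else 0))" (is "unitary_uhf (of_wmat k ?V)")
proof -
  have inj: "h s = h t \<longleftrightarrow> s = t" if "s \<in> words k" "t \<in> words k" for s t
    using h that by (auto simp: bij_betw_def inj_on_def)
  have "of_wmat k (wmult k ?V (wadj ?V)) = of_wmat k wid"
  proof (rule of_wmat_cong)
    fix s t :: "'n list" assume s: "s \<in> words k" and t: "t \<in> words k"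
    have "wmult k ?V (wadj ?V) s t = (\<Sum>r\<in>words k. if r = h s then (if s = t then f s * cnj (f t) else 0) else 0)"
      unfolding wmult_def wadj_def using inj[OF s t] by (intro sum.cong refl) auto
    also have "\<dots> = wid s t"
      using h s by (auto simp: wid_def cnj_mult_self_unit f bij_betw_def)
    finally show "wmult k ?V (wadj ?V) s t = wid s t" .
  qed
  moreover have "of_wmat k (wmult k (wadj ?V) ?V) = of_wmat k wid"
  proof (rule of_wmat_cong)
    fix s t :: "'n list" assume s: "s \<in> words k" and t: "t \<in> words k"
    obtain q where q: "q \<in> words k" "s = h q" using h s by (auto simp: bij_betw_def)
    have "wmult k (wadj ?V) ?V s t = (\<Sum>r\<in>words k. if r = q then (if s = t then cnj (f q) * f q else 0) else 0)"
      unfolding wmult_def wadj_def using inj[OF q(1)] q by (intro sum.cong refl) auto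
    also have "\<dots> = wid s t"
      using q by (simp add: wid_def cnj_mult_self_unit f)
    finally show "wmult k (wadj ?V) ?V s t = wid s t" .
  qed
  ultimately show ?thesis
    by (simp add: unitary_uhf_def uadj_of_wmat times_of_wmat uone_of_wmat[of k])
qed

lemma unitary_weyl:
  fixes w :: "'n :: finite \<Rightarrow> complex"
  assumes w: "\<And>i. cmod (w i) = 1" and a: "a \<in> words k"
  shows "unitary_uhf (weyl w k a b)"
proof -
  let ?f = "\<lambda>s. w (hd s) * cnj (w (hd (map2 dif s a))) * wchi s b"
  have "unitary_uhf (of_wmat k (\<lambda>s t. if t = map2 dif s a then ?f s else 0))"
    by (rule unitary_uhf_weighted_permutation[OF bij_map2_dif[OF a]]) (simp add: norm_mult w)
  also have "of_wmat k (\<lambda>s t. if t = map2 dif s a then ?f s else 0) = weyl w k a b"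
    unfolding weyl_def by (rule of_wmat_cong) simp
  finally show ?thesis .
qed

lemma map2_dif_rot:
  "length s = length a \<Longrightarrow> map2 dif (map (rot m) s) a = map (rot m) (map2 dif s a)"
  by (auto simp: list_eq_iff_nth_eq dif_def rot_rot add.commute)

lemma wchi_rot:
  "wchi (map (rot m) s) b = (\<Prod>i<length s. zeta TYPE('n) ^ pos (b ! i)) ^ m * wchi s b"
  for s b :: "'n :: finite list"
  by (simp add: wchi_def chi_rot prod.distrib mult.commute[of m] power_mult flip: prod_power_distrib)

text \<open>
  Translations commute with rotation, and rotation multiplies the character \<open>b\<close> by a root of unity.
\<close>

lemma weyl_in_eigenspace:
  fixes w :: "'n :: finite \<Rightarrow> complex"
  assumes w: "\<And>i. cmod (w i) = 1" and a: "a \<in> words k" and k: "0 < k"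
  shows "\<exists>z. cmod z = 1 \<and> weyl w k a b \<in> eigenspace w z"
proof -
  define z where "z = (\<Prod>i<k. zeta TYPE('n) ^ pos (b ! i))"
  have "weyl w k a b \<in> eigenspace w z"
    unfolding weyl_def
  proof (rule of_wmat_in_eigenspace[OF w k])
    fix m and s t :: "'n list" assume s: "s \<in> words k" and t: "t \<in> words k"
    have "map2 dif (map (rot m) s) a = map (rot m) (map2 dif s a)"
      using s a by (intro map2_dif_rot) (simp add: words_def)
    then have "map (rot m) t = map2 dif (map (rot m) s) a \<longleftrightarrow> t = map2 dif s a"
      by (simp only: inj_map_eq_map[OF bij_is_inj[OF bij_rot]])
    then show "(if map (rot m) t = map2 dif (map (rot m) s) a then wchi (map (rot m) s) b else 0)
        = z ^ m * (if t = map2 dif s a then wchi s b else 0)"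
      using s by (simp add: wchi_rot z_def words_def)
  qed
  moreover have "cmod z = 1" by (simp add: z_def norm_power flip: prod_norm)
  ultimately show ?thesis by blast
qed

lemma sum_of_wmat:
  fixes f :: "'i \<Rightarrow> ('n :: finite) wmat"
  shows "finite I \<Longrightarrow> (\<Sum>i\<in>I. of_wmat k (f i)) = of_wmat k (\<lambda>s t. \<Sum>i\<in>I. f i s t)"
proof (induction I rule: finite_induct)
  case empty
  have "(0 :: 'n uhf) = of_wmat k (\<lambda>s t. 0)"
    by transfer (auto simp: wmat_kernel_def fun_eq_iff)
  then show ?case by simp
next
  case (insert i I)
  then show ?case by (simp add: plus_of_wmat)
qed

text \<open>
  Each entry \<open>(s, t)\<close> lies in the support of the translation by \<open>s - t\<close> alone; on this support the
  coefficients are given by Fourier inversion over the words \<open>s\<close>.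
\<close>

lemma weyl_span:
  fixes w :: "'n :: finite \<Rightarrow> complex"
  assumes w: "\<And>i. cmod (w i) = 1"
  shows "of_wmat k p \<in> range (\<lambda>c. \<Sum>(a, b)\<in>words k \<times> words k. c (a, b) *\<^sub>C weyl w k a b)"
proof -
  define N where "N = (of_nat (CARD('n) ^ k) :: complex)"
  have N: "N \<noteq> 0" by (simp add: N_def)
  define g where "g a s = cnj (w (hd s)) * p s (map2 dif s a) * w (hd (map2 dif s a))" for a s
  define c where "c = (\<lambda>(a, b). (\<Sum>s\<in>words k. g a s * cnj (wchi s b)) / N)"
  have "(\<Sum>(a, b)\<in>words k \<times> words k. c (a, b) *\<^sub>C weyl w k a b)
      = of_wmat k (\<lambda>s t. \<Sum>(a, b)\<in>words k \<times> words k. c (a, b) * (w (hd s) * cnj (w (hd t))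
          * (if t = map2 dif s a then wchi s b else 0)))"
    by (simp add: weyl_def scaleC_of_wmat case_prod_beta' sum_of_wmat)
  also have "\<dots> = of_wmat k p"
  proof (rule of_wmat_cong)
    fix s t :: "'n list" assume s: "s \<in> words k" and t: "t \<in> words k"
    let ?a = "map2 dif s t"
    have a: "?a \<in> words k" using s t by (simp add: words_def)
    have ta: "t = map2 dif s ?a" by (rule iffD2[OF map2_dif_eq_iff[OF s t a] refl])
    have inv: "(\<Sum>b\<in>words k. c (?a, b) * wchi s b) = g ?a s"
    proof -
      have "(\<Sum>b\<in>words k. c (?a, b) * wchi s b)
          = (\<Sum>b\<in>words k. \<Sum>s'\<in>words k. g ?a s' / N * (wchi s b * cnj (wchi s' b)))"
        unfolding c_def prod.case sum_divide_distrib sum_distrib_right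
        by (intro sum.cong refl) (simp only: times_divide_eq_left times_divide_eq_right mult_ac)
      also have "\<dots> = (\<Sum>s'\<in>words k. g ?a s' / N * (\<Sum>b\<in>words k. wchi s b * cnj (wchi s' b)))"
        by (subst sum.swap) (simp add: sum_distrib_left)
      also have "\<dots> = (\<Sum>s'\<in>words k. if s' = s then g ?a s else 0)"
        using N by (intro sum.cong refl) (auto simp: wchi_orthogonal[OF s] N_def)
      finally show ?thesis using s by simp
    qed
    have "(\<Sum>(a, b)\<in>words k \<times> words k. c (a, b) * (w (hd s) * cnj (w (hd t))
          * (if t = map2 dif s a then wchi s b else 0)))
        = (\<Sum>a\<in>words k. \<Sum>b\<in>words k. c (a, b) * (w (hd s) * cnj (w (hd t))
          * (if t = map2 dif s a then wchi s b else 0)))"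
      by (simp add: sum.cartesian_product)
    also have "\<dots> = (\<Sum>a\<in>words k. if a = ?a
        then w (hd s) * cnj (w (hd t)) * (\<Sum>b\<in>words k. c (?a, b) * wchi s b) else 0)"
      by (intro sum.cong refl) (auto simp: map2_dif_eq_iff[OF s t] sum_distrib_left mult_ac)
    also have "\<dots> = w (hd s) * cnj (w (hd t)) * g ?a s"
      using a by (simp add: inv)
    also have "\<dots> = (w (hd s) * cnj (w (hd s))) * (w (hd t) * cnj (w (hd t))) * p s t"
      unfolding g_def ta[symmetric] by (simp add: mult_ac)
    finally show "(\<Sum>(a, b)\<in>words k \<times> words k. c (a, b) * (w (hd s) * cnj (w (hd t))
          * (if t = map2 dif s a then wchi s b else 0))) = p s t"
      by (simp add: cnj_mult_self_unit w)
  qed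
  finally show ?thesis by (intro range_eqI) (rule sym)
qed

text \<open>
  The Weyl unitaries have eigenvalues of modulus \<open>1\<close>, which cancel in \<open>v x v\<^sup>*\<close>.
\<close>

lemma regular_twisted_fourier:
  fixes w :: "'n :: finite \<Rightarrow> complex"
  assumes w: "\<And>i. cmod (w i) = 1"
  shows "regular_inclusion (spin_subfactor (twisted_fourier w)) hyperfinite_factor"
  unfolding spin_subfactor_twisted_fourier[OF w]
proof (rule regular_inclusion_closureI)
  let ?V = "{weyl w k a b | k a b. 0 < k \<and> a \<in> words k}"
  show "unitary_uhf v" if "v \<in> ?V" for v
    using that by (auto intro: unitary_weyl w)
  show "v * x * uadj v \<in> eigenspace w 1" "uadj v * x * v \<in> eigenspace w 1"
    if v: "v \<in> ?V" and x: "x \<in> eigenspace w 1" for v x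
  proof -
    obtain k a b where v: "v = weyl w k a b" "0 < k" "a \<in> words k" using v by blast
    obtain z where "cmod z = 1" "v \<in> eigenspace w z"
      using weyl_in_eigenspace[of w a k b] w v by blast
    then show "v * x * uadj v \<in> eigenspace w 1" "uadj v * x * v \<in> eigenspace w 1"
      using eigenspace_conjugate[of w z v x] w x by blast+
  qed
  show "\<exists>I c v. finite I \<and> v ` I \<subseteq> ?V \<and> x = (\<Sum>i\<in>(I :: ('n list \<times> 'n list) set). c i *\<^sub>C v i)" for x
  proof -
    obtain l q where "x = of_wmat l q" using uhf_exhaust by blast
    then obtain p where "x = of_wmat (Suc l) p" using of_wmat_mono[of l "Suc l" q] by auto
    then obtain c where "x = (\<Sum>(a, b)\<in>words (Suc l) \<times> words (Suc l). c (a, b) *\<^sub>C weyl w (Suc l) a b)"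
      using weyl_span[of w "Suc l" p] w by auto
    then show ?thesis
      by (intro exI[of _ "words (Suc l) \<times> words (Suc l)"] exI[of _ c]
          exI[of _ "\<lambda>(a, b). weyl w (Suc l) a b"]) (force simp: case_prod_beta')
  qed
qed


section \<open>Distinguishing the subfactors\<close>

text \<open>
  Up to the factor \<open>1 / n\<close>, the \<open>(i, j)\<close> entry of the conditional expectation onto the first tensor factor.
\<close>

definition entry_functional :: "'n \<Rightarrow> 'n \<Rightarrow> (('n :: finite) gns \<Rightarrow>\<^sub>L 'n gns) \<Rightarrow> complex" where
  "entry_functional i j T
    = cinner (to_completion (of_wmat 1 (matrix_unit i j))) (blinfun_apply T (to_completion uone))"

lemma entry_functional_gns_rep:
  fixes p :: "('n :: finite) wmat"
  shows "entry_functional i j (gns_rep (of_wmat (Suc m) p))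
    = (\<Sum>q\<in>words m. p (i # q) (j # q)) / of_nat (CARD('n) ^ Suc m)"
proof -
  have sum: "(\<Sum>s\<in>words (Suc m). f s) = (\<Sum>a\<in>UNIV. \<Sum>q\<in>words m. f (a # q))"
    for f :: "'n list \<Rightarrow> complex"
    using sum_words_add[of f "Suc 0" m] by (simp add: sum_words_1)
  have unit: "of_wmat (Suc m) p * uone = of_wmat (Suc m) p"
    unfolding uone_of_wmat[of "Suc m"] times_of_wmat
  proof (rule of_wmat_cong)
    fix s t :: "'n list" assume "t \<in> words (Suc m)"
    moreover have "(\<Sum>r\<in>words (Suc m). p s r * wid r t) = (\<Sum>r\<in>words (Suc m). if r = t then p s r else 0)"
      by (intro sum.cong refl) (simp add: wid_def)
    ultimately show "wmult (Suc m) p wid s t = p s t" by (simp add: wmult_def)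
  qed
  have "entry_functional i j (gns_rep (of_wmat (Suc m) p))
      = cinner (of_wmat (Suc 0 + m) (wtensor (Suc 0) (matrix_unit i j) wid)) (of_wmat (Suc m) p)"
    unfolding of_wmat_tensor
    by (simp add: entry_functional_def gns_rep_to_completion cinner_to_completion unit)
  also have "\<dots> = (\<Sum>a\<in>UNIV. \<Sum>q\<in>words m. \<Sum>b\<in>UNIV. \<Sum>r\<in>words m.
      cnj (wtensor (Suc 0) (matrix_unit i j) wid (a # q) (b # r)) * p (a # q) (b # r))
      / of_nat (CARD('n) ^ Suc m)"
    by (simp add: cinner_of_wmat sum)
  also have "(\<Sum>a\<in>UNIV. \<Sum>q\<in>words m. \<Sum>b\<in>UNIV. \<Sum>r\<in>words m.
      cnj (wtensor (Suc 0) (matrix_unit i j) wid (a # q) (b # r)) * p (a # q) (b # r))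
    = (\<Sum>a\<in>UNIV. \<Sum>q\<in>words m. \<Sum>b\<in>UNIV. \<Sum>r\<in>words m.
      if r = q then (if b = j then (if a = i then p (i # q) (j # q) else 0) else 0) else 0)"
    by (intro sum.cong refl) (auto simp: wtensor_def matrix_unit_def wid_def)
  also have "\<dots> = (\<Sum>a\<in>UNIV. if a = i then (\<Sum>q\<in>words m. p (i # q) (j # q)) else 0)"
    by (intro sum.cong refl) simp
  finally show ?thesis by simp
qed

lemma continuous_entry_functional: "continuous_map wot euclidean (entry_functional i j)"
  unfolding entry_functional_def by (rule continuous_map_matrix_coefficient)

text \<open>
  Pairing with matrix units of the first tensor factor is weakly continuous and averages over
  all other letters; the average over words is unchanged by a rotation.
\<close>

lemma entry_functional_rot:
  fixes w :: "'n :: finite \<Rightarrow> complex"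
  assumes T: "T \<in> wot closure_of gns_rep ` eigenspace w 1"
  shows "cnj (w (rot m i)) * entry_functional (rot m i) (rot m j) T * w (rot m j)
    = cnj (w i) * entry_functional i j T * w j"
proof -
  let ?d = "\<lambda>T. cnj (w (rot m i)) * entry_functional (rot m i) (rot m j) T * w (rot m j)
    - cnj (w i) * entry_functional i j T * w j"
  have "?d (gns_rep x) = 0" if x: "x \<in> eigenspace w 1" for x
  proof -
    obtain l q where "x = of_wmat l q" using uhf_exhaust by blast
    then obtain p where p: "x = of_wmat (Suc l) p" using of_wmat_mono[of l "Suc l" q] by auto
    have bij: "bij_betw (map (rot m)) (words l) (words l :: 'n list set)"
    proof -
      have "inj_on (map (rot m)) (words l :: 'n list set)"
        by (intro inj_onI) (simp add: inj_map_eq_map[OF bij_is_inj[OF bij_rot]])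
      moreover have "map (rot m) ` words l \<subseteq> (words l :: 'n list set)" by (auto simp: words_def)
      ultimately show ?thesis by (simp add: bij_betw_def endo_inj_surj)
    qed
    have "cnj (w (rot m i)) * (\<Sum>q\<in>words l. p (rot m i # q) (rot m j # q)) * w (rot m j)
        = (\<Sum>q\<in>words l. cnj (w (rot m i)) * p (rot m i # map (rot m) q) (rot m j # map (rot m) q) * w (rot m j))"
      using sum.reindex_bij_betw[OF bij, of "\<lambda>q. p (rot m i # q) (rot m j # q)"]
      by (simp flip: sum_distrib_left sum_distrib_right)
    also have "\<dots> = (\<Sum>q\<in>words l. cnj (w i) * p (i # q) (j # q) * w j)"
    proof (intro sum.cong refl)
      fix q :: "'n list" assume "q \<in> words l"
      then show "cnj (w (rot m i)) * p (rot m i # map (rot m) q) (rot m j # map (rot m) q) * w (rot m j)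
          = cnj (w i) * p (i # q) (j # q) * w j"
        using eigenspace_entry[OF x[unfolded p], of "i # q" "j # q" m] by (simp add: words_def)
    qed
    finally show ?thesis
      by (simp add: p entry_functional_gns_rep sum_distrib_left sum_distrib_right flip: divide_inverse)
  qed
  moreover have "continuous_map wot euclidean ?d"
  proof (rule continuous_map_diff)
    have "continuous_map wot euclidean (\<lambda>T. a * entry_functional k l T * b)" for a b and k l :: 'n
      using continuous_map_compose[OF continuous_entry_functional, of euclidean "\<lambda>z. a * z * b" k l]
      by (simp add: comp_def continuous_intros)
    then show "continuous_map wot euclidean
        (\<lambda>T. cnj (w (rot m i)) * entry_functional (rot m i) (rot m j) T * w (rot m j))"
      "continuous_map wot euclidean (\<lambda>T. cnj (w i) * entry_functional i j T * w j)" by blast+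
  qed
  ultimately have "?d ` (wot closure_of gns_rep ` eigenspace w 1) \<subseteq> euclidean closure_of {0}"
    by (intro closure_of_mapsto) auto
  with T show ?thesis by auto
qed

text \<open>
  The rank one matrix \<open>x\<close> with entries \<open>w'(i) w'(j)\<^sup>*\<close> is a fixed point for \<open>w'\<close>. If the subfactors agree,
  \<open>entry_functional_rot\<close> applies to it with \<open>w\<close>.
\<close>

lemma twisted_fourier_same_subfactor:
  fixes w w' :: "'n :: finite \<Rightarrow> complex"
  assumes w: "\<And>i. cmod (w i) = 1" and w': "\<And>i. cmod (w' i) = 1"
    and eq: "spin_subfactor (twisted_fourier w) = spin_subfactor (twisted_fourier w')"
  shows "cnj (w (rot m i)) * w' (rot m i) * cnj (cnj (w (rot m j)) * w' (rot m j))
    = cnj (w i) * w' i * cnj (cnj (w j) * w' j)"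
proof -
  define x :: "'n uhf" where "x = of_wmat (Suc 0) (\<lambda>s t. w' (hd s) * cnj (w' (hd t)) * 1)"
  have "x \<in> eigenspace w' 1"
    unfolding x_def by (rule of_wmat_in_eigenspace[OF w']) auto
  then have "gns_rep x \<in> wot closure_of gns_rep ` eigenspace w' 1"
    using closure_of_subset[of "gns_rep ` eigenspace w' 1" wot] gns_rep_in_bounded_ops
    by (auto simp: topspace_wot)
  then have "gns_rep x \<in> wot closure_of gns_rep ` eigenspace w 1"
    using eq by (simp add: spin_subfactor_twisted_fourier w w')
  from entry_functional_rot[OF this, of m i j] show ?thesis
    by (simp add: x_def entry_functional_gns_rep words_def mult_ac)
qed

text \<open>
  One nontrivial phase is enough to move the subfactor.
\<close>

definition phase :: "real \<Rightarrow> 'n :: finite \<Rightarrow> complex" where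
  "phase \<theta> i = (if i = letter 0 then cis \<theta> else 1)"

text \<open>
  The ratio between the values of \<open>h = w' / w\<close> at cyclically consecutive letters is constant. Entering and
  leaving the exceptional letter, it is \<open>h i\<close> and its inverse, so \<open>h i = e\<^bsup>i(\<theta>'-\<theta>)\<^esup>\<close> is
  real; as \<open>\<bar>\<theta>' - \<theta>\<bar> < 1 < \<pi>\<close>, this forces equality.
\<close>

lemma phase_separates:
  assumes card: "CARD('n :: finite) \<ge> 2" and \<theta>: "\<theta> \<in> {0<..<1}" "\<theta>' \<in> {0<..<1}"
    and eq: "spin_subfactor (twisted_fourier (phase \<theta> :: 'n \<Rightarrow> complex))
      = spin_subfactor (twisted_fourier (phase \<theta>'))"
  shows "\<theta> = \<theta>'"
proof -
  define i :: 'n where "i = letter 0"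
  define j where "j = rot (CARD('n) - 1) i"
  define h where "h k = cnj (phase \<theta> k) * phase \<theta>' k" for k :: 'n
  \<comment> \<open>With at least two letters the neighbours of the exceptional letter have trivial phase.\<close>
  have i: "rot 1 i \<noteq> i"
    using card by (simp add: i_def pos_rot pos_letter flip: pos_inject)
  have rj: "rot 1 j = i"
    unfolding j_def rot_rot by (rule rot_full) simp
  then have j: "j \<noteq> i" using i by metis
  have "h (rot 1 i) * cnj (h (rot 1 j)) = h i * cnj (h j)"
    unfolding h_def by (rule twisted_fourier_same_subfactor[OF _ _ eq]) (simp_all add: phase_def)
  then have "cnj (h i) = h i"
    using i j unfolding rj by (simp add: h_def phase_def i_def)
  moreover have "h i = cis (\<theta>' - \<theta>)"
    by (simp add: h_def phase_def i_def cis_cnj cis_mult)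
  ultimately have "sin (\<theta>' - \<theta>) = 0"
    by (simp add: complex_eq_iff)
  moreover have "- pi < \<theta>' - \<theta>" "\<theta>' - \<theta> < pi"
    using \<theta> pi_gt3 by auto
  ultimately show ?thesis
    using sin_eq_0_pi[of "\<theta>' - \<theta>"] by simp
qed

theorem proposition3p24:
  assumes "CARD('n :: finite) \<ge> 2"
  shows "\<exists>U :: (complex ^ 'n ^ 'n) set.
    uncountable U \<and>
    (\<forall>u\<in>U. hadamard_unitary u) \<and>
    inj_on spin_subfactor U \<and>
    (\<forall>u\<in>U. regular_inclusion (spin_subfactor u) hyperfinite_factor)"
proof -
  let ?u = "\<lambda>\<theta>. twisted_fourier (phase \<theta> :: 'n \<Rightarrow> complex)"
  have unit: "cmod (phase \<theta> i) = 1" for \<theta> and i :: 'n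
    by (simp add: phase_def)
  have sep: "\<theta> = \<theta>'" if "\<theta> \<in> {0<..<1}" "\<theta>' \<in> {0<..<1}" "spin_subfactor (?u \<theta>) = spin_subfactor (?u \<theta>')"
    for \<theta> \<theta>'
    using phase_separates[OF assms that] .
  have "inj_on ?u {0<..<1}"
    using sep by (metis (mono_tags, lifting) inj_onI)
  then have "uncountable (?u ` {0<..<1})"
    using uncountable_open_interval[of 0 1] countable_image_inj_on by force
  moreover have "inj_on spin_subfactor (?u ` {0<..<1})"
    using sep by (intro inj_onI) blast
  ultimately show ?thesis
    using hadamard_twisted_fourier[of "phase _"] regular_twisted_fourier[of "phase _"] unit
    by (intro exI[of _ "?u ` {0<..<1}"]) blast
qed

end
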